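(* Let $K$ be a finite ordered simplicial complex of pure dimension $m$ and, for each top-dimensional simplex $\Delta\in K$, let $\mathcal{R}_\Delta\subset J^1(\Delta,\mathbb{R}^n)$ be an open and fiberwise dense differential relation; write $\mathcal{R}=\{\mathcal{R}_\Delta\}$. Then for every $\epsilon>0$ and every map $s:|K|\to\mathbb{R}^n$ that is piecewise smooth with respect to $K$, there exist $\ell\in\mathbb{N}$ and an $\epsilon$-jiggling $(s',K_\ell)$ of $(s,K)$ such that $s'$ is piecewise linear with respect to the $\ell$th crystalline subdivision $K_\ell$ of $K$, and $s'$ is a piecewise solution of $\mathcal{R}$.
   Context: A simplicial complex is a locally finite set of linear simplices in $\mathbb{R}^N$ closed under faces with pairwise intersections common faces; it is ordered if its vertex set is totally ordered (so each simplex is ordered), and of pure dimension $m$ if every simplex is a face of an $m$-simplex. Crystalline subdivision: for an ordered linear $m$-simplex $\Delta=\langle v_0,\dots,v_m\rangle$ with $m>0$, let $\iota:\Delta\to[0,1]^m$ be the affine map with $\iota(v_j)=(0,\dots,0,1,\dots,1)$ ($j$ zeros followed by $m-j$ ones); subdivide $[0,1]^m$ into $2^{\ell m}$ cubes of side $2^{-\ell}$ and each such cube into the $m!$ simplices that are rescaled translates of $\{0\le x_{\pi(1)}\le\dots\le x_{\pi(m)}\le 1\}$, $\pi$ a permutation; pulling back via $\iota$ gives the $\ell$th crystalline subdivision of $\Delta$ (a $0$-simplex is its own subdivision), and $K_\ell$ is the union of those of all simplices of $K$. A map is piecewise smooth (resp. piecewise linear) with respect to a complex if it is continuous and smooth (resp.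 affine) on each of its simplices. For $\Delta\in K$ top-dimensional, $J^1(\Delta,\mathbb{R}^n)$ is the 1-jet space of maps $\Delta\to\mathbb{R}^n$; fiberwise dense means that over each point $(x,y)\in\Delta\times\mathbb{R}^n$ the set of slopes $A\in\operatorname{Hom}(\mathbb{R}^m,\mathbb{R}^n)$ with $(x,y,A)\in\mathcal{R}_\Delta$ is dense. Relations pull back to the simplices of a subdivision, and a map piecewise smooth with respect to $K_\ell$ is a piecewise solution if on every top simplex of $K_\ell$ (contained in $\Delta\in K$) its 1-jet lies in $\mathcal{R}_\Delta$. For maps $f_1,f_2$ piecewise smooth with respect to $K_1,K_2$, $d_{C^1}(f_1,f_2)<\epsilon$ means that on every top simplex of a common subdivision of $K_1,K_2,K$ the restrictions are $C^1$-close with respect to the Euclidean metric. $(f_2,K_2)$ is an $\epsilon$-jiggling of $(f_1,K_1)$ if $K_2$ subdivides $K_1$ and $d_{C^1}(f_1,f_2)<\epsilon$. *)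

theory Defs
  imports "HOL-Analysis.Analysis"
begin

definition simplicial_complex :: "'a::euclidean_space set set \<Rightarrow> bool" where
  "simplicial_complex K \<longleftrightarrow>
     (\<forall>S\<in>K. S \<noteq> {} \<and> finite S \<and> \<not> affine_dependent S) \<and>
     (\<forall>S\<in>K. \<forall>T. T \<noteq> {} \<and> T \<subseteq> S \<longrightarrow> T \<in> K) \<and>
     (\<forall>S\<in>K. \<forall>T\<in>K. convex hull S \<inter> convex hull T = convex hull (S \<inter> T))"

definition polyhedron :: "'a::euclidean_space set set \<Rightarrow> 'a set" where
  "polyhedron K = (\<Union>S\<in>K. convex hull S)"

definition pure_dim :: "'a set set \<Rightarrow> nat \<Rightarrow> bool" where
  "pure_dim K m \<longleftrightarrow> (\<forall>S\<in>K. \<exists>T\<in>K. S \<subseteq> T \<and> card T = m + 1)"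

definition ordered_vertices :: "('a \<times> 'a) set \<Rightarrow> 'a set \<Rightarrow> 'a list" where
  "ordered_vertices ord S =
     (THE vs. set vs = S \<and> distinct vs \<and> sorted_wrt (\<lambda>a b. (a, b) \<in> ord) vs)"

fun iter_dderiv :: "('a::real_normed_vector \<Rightarrow> 'b::real_normed_vector) \<Rightarrow> 'a list \<Rightarrow> 'a \<Rightarrow> 'b" where
  "iter_dderiv f [] = f"
| "iter_dderiv f (v # vs) = (\<lambda>x. frechet_derivative (iter_dderiv f vs) (at x) v)"

definition C_infinity_on :: "'a::real_normed_vector set \<Rightarrow> ('a \<Rightarrow> 'b::real_normed_vector) \<Rightarrow> bool" where
  "C_infinity_on U f \<longleftrightarrow> open U \<and> (\<forall>vs. iter_dderiv f vs differentiable_on U)"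

definition smooth_on_set :: "'a::real_normed_vector set \<Rightarrow> ('a \<Rightarrow> 'b::real_normed_vector) \<Rightarrow> bool" where
  "smooth_on_set S f \<longleftrightarrow> (\<exists>U g. S \<subseteq> U \<and> C_infinity_on U g \<and> (\<forall>x\<in>S. g x = f x))"

definition piecewise_smooth :: "'a::euclidean_space set set \<Rightarrow> ('a \<Rightarrow> 'b::euclidean_space) \<Rightarrow> bool" where
  "piecewise_smooth K f \<longleftrightarrow>
     continuous_on (polyhedron K) f \<and> (\<forall>S\<in>K. smooth_on_set (convex hull S) f)"

definition tangent_space :: "'a::euclidean_space set \<Rightarrow> 'a set" where
  "tangent_space S = span {u - v | u v. u \<in> S \<and> v \<in> S}"

text \<open>Slopes Hom(T S, R^n), realised as linear maps vanishing on the orthogonal complement of T S.\<close>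
definition slopes :: "'a::euclidean_space set \<Rightarrow> ('a \<Rightarrow>\<^sub>L 'b::euclidean_space) set" where
  "slopes S = {L. \<forall>w. (\<forall>u\<in>tangent_space S. inner w u = 0) \<longrightarrow> blinfun_apply L w = 0}"

definition jet_space :: "'a::euclidean_space set \<Rightarrow> ('a \<times> 'b::euclidean_space \<times> ('a \<Rightarrow>\<^sub>L 'b)) set" where
  "jet_space S = convex hull S \<times> UNIV \<times> slopes S"

definition open_relation :: "'a::euclidean_space set \<Rightarrow> ('a \<times> 'b::euclidean_space \<times> ('a \<Rightarrow>\<^sub>L 'b)) set \<Rightarrow> bool" where
  "open_relation S R \<longleftrightarrow> R \<subseteq> jet_space S \<and> openin (top_of_set (jet_space S)) R"

definition fiberwise_dense :: "'a::euclidean_space set \<Rightarrow> ('a \<times> 'b::euclidean_space \<times> ('a \<Rightarrow>\<^sub>L 'b)) set \<Rightarrow> bool" where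
  "fiberwise_dense S R \<longleftrightarrow>
     (\<forall>x\<in>convex hull S. \<forall>y. slopes S \<subseteq> closure {A. (x, y, A) \<in> R})"

text \<open>Coordinates x_1..x_m of [0,1]^m as a function nat => real, padded by x_0 = 0, x_(m+1) = 1.\<close>
definition ext_coord :: "nat \<Rightarrow> (nat \<Rightarrow> real) \<Rightarrow> nat \<Rightarrow> real" where
  "ext_coord m x k = (if k = 0 then 0 else if k = m + 1 then 1 else x k)"

text \<open>Inverse of iota: the point of the simplex [v_0,...,v_m] with iota-coordinates x
  (barycentric coordinate of v_j is x_(j+1) - x_j).\<close>
definition iota_inv :: "'a::real_vector list \<Rightarrow> (nat \<Rightarrow> real) \<Rightarrow> 'a" where
  "iota_inv vs x =
     (\<Sum>j<length vs. (ext_coord (length vs - 1) x (j + 1) - ext_coord (length vs - 1) x j) *\<^sub>R vs ! j)"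

text \<open>k-th vertex (k = 1..m+1) of the small simplex
  {0 <= y_pi(1) <= ... <= y_pi(m) <= 1}, y = 2^l x - c, in the cube with corner c/2^l.\<close>
definition crys_vertex :: "nat \<Rightarrow> nat \<Rightarrow> (nat \<Rightarrow> nat) \<Rightarrow> (nat \<Rightarrow> nat) \<Rightarrow> nat \<Rightarrow> nat \<Rightarrow> real" where
  "crys_vertex m l c \<pi> k =
     (\<lambda>i. (real (c i) + (if i \<in> \<pi> ` {k..m} then 1 else 0)) / 2 ^ l)"

text \<open>The top-dimensional simplices (as point sets) of the l-th crystalline subdivision of
  the ordered simplex with vertex set S: pull-backs via iota of the small simplices lying in iota(S).\<close>
definition crys_simplices :: "('a::euclidean_space \<times> 'a) set \<Rightarrow> nat \<Rightarrow> 'a set \<Rightarrow> 'a set set" where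
  "crys_simplices ord l S =
     (let vs = ordered_vertices ord S; m = length vs - 1 in
      {convex hull (iota_inv vs ` crys_vertex m l c \<pi> ` {1..m+1}) | c \<pi>.
         (\<forall>i\<in>{1..m}. c i < 2 ^ l) \<and> bij_betw \<pi> {1..m} {1..m} \<and>
         (\<forall>k\<in>{1..m+1}. \<forall>i\<in>{1..<m}. crys_vertex m l c \<pi> k i \<le> crys_vertex m l c \<pi> k (Suc i))})"

text \<open>Piecewise linear w.r.t. K_l: continuous, affine on every simplex of K_l
  (equivalently on the maximal simplices of the subdivisions of the simplices of K).\<close>
definition piecewise_linear_crys ::
  "'a::euclidean_space set set \<Rightarrow> ('a \<times> 'a) set \<Rightarrow> nat \<Rightarrow> ('a \<Rightarrow> 'b::euclidean_space) \<Rightarrow> bool" where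
  "piecewise_linear_crys K ord l f \<longleftrightarrow>
     continuous_on (polyhedron K) f \<and>
     (\<forall>S\<in>K. \<forall>\<sigma>\<in>crys_simplices ord l S. \<exists>A b. linear A \<and> (\<forall>x\<in>\<sigma>. f x = A x + b))"

definition piecewise_solution ::
  "'a::euclidean_space set set \<Rightarrow> ('a \<times> 'a) set \<Rightarrow> nat \<Rightarrow>
   ('a set \<Rightarrow> ('a \<times> 'b::euclidean_space \<times> ('a \<Rightarrow>\<^sub>L 'b)) set) \<Rightarrow> nat \<Rightarrow> ('a \<Rightarrow> 'b) \<Rightarrow> bool" where
  "piecewise_solution K ord m R l f \<longleftrightarrow>
     (\<forall>S\<in>K. card S = m + 1 \<longrightarrow> (\<forall>\<sigma>\<in>crys_simplices ord l S. \<forall>x\<in>\<sigma>.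
        \<exists>L\<in>slopes S. (f has_derivative blinfun_apply L) (at x within \<sigma>) \<and> (x, f x, L) \<in> R S))"

text \<open>d_C1(f,g) < eps on every top simplex of K_l (a common subdivision of K, K_l).\<close>
definition C1_close ::
  "'a::euclidean_space set set \<Rightarrow> ('a \<times> 'a) set \<Rightarrow> nat \<Rightarrow> nat \<Rightarrow> ('a \<Rightarrow> 'b::euclidean_space) \<Rightarrow> ('a \<Rightarrow> 'b) \<Rightarrow> real \<Rightarrow> bool" where
  "C1_close K ord m l f g \<epsilon> \<longleftrightarrow>
     (\<forall>S\<in>K. card S = m + 1 \<longrightarrow> (\<forall>\<sigma>\<in>crys_simplices ord l S. \<forall>x\<in>\<sigma>.
        norm (f x - g x) < \<epsilon> \<and>
        (\<exists>L\<in>slopes S. \<exists>L'\<in>slopes S. (f has_derivative blinfun_apply L) (at x within \<sigma>) \<and>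
            (g has_derivative blinfun_apply L') (at x within \<sigma>) \<and> norm (L - L') < \<epsilon>)))"

end

theory Submission
  imports Defs
begin

text \<open>Write \<open>s'\<close> as the piecewise linear interpolation on \<open>K\<^sub>l\<close> of values \<open>y u\<close> at its vertices \<open>u\<close>.
  Starting from \<open>y = s\<close>, moving every value by at most \<open>\<delta> / 2 ^ l\<close> changes the slopes by \<open>O(\<delta>)\<close>,
  uniformly in \<open>l\<close>, because the simplices of \<open>K\<^sub>l\<close> have finitely many shapes up to scaling; and
  the slope of a single simplex can be prescribed freely by moving its vertices.

  The top simplices of \<open>K\<^sub>l\<close> are coloured by the simplex \<open>S \<in> K\<close> containing them, the corner of their
  cube modulo 2 and the permutation \<open>\<pi>\<close>. The number of colours does not depend on \<open>l\<close>, and simplices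
  of equal colour have no common vertex, so all slopes of one colour can be moved into the relation
  independently of each other. By compactness this achieves a distance to the complement of the
  relation that is independent of \<open>l\<close>, and the next colours are treated with perturbations so small
  that the slopes of the previous ones stay inside. A simplex small enough relative
  to the final distance then lies in the relation at all of its points.\<close>

section \<open>Global barycentric coordinates\<close>

text \<open>The map \<open>s'\<close> has to be continuous where cells of different simplices of
  \<open>K\<close> meet. Instead of proving that the cells fit together into a complex, one global
  formula defines the interpolation. Sums of barycentric coordinates over the vertices up to a given
  one make sense on all of \<open>K\<close>, because passing to a face only drops vanishing
  summands. On each simplex they are its cube coordinates, possibly repeated, or the constants 0 and
  1. In these coordinates the nodal functions have a closed form, so continuity is immediate and
  only affinity on each cell needs an argument.

  During the jiggling, the distance to the complement of the relation is measured at a base vertex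
  of each cell and at the original value of \<open>s\<close> there. Perturbations then affect the
  slope alone, and the variation of point and value over a cell, which is of order
  \<open>1 / 2 ^ l\<close>, is paid for once, by the final choice of \<open>l\<close>.\<close>

lemma sorted_wrt_unique:
  assumes "antisym r" "sorted_wrt (\<lambda>a b. (a, b) \<in> r) xs" "sorted_wrt (\<lambda>a b. (a, b) \<in> r) ys"
    and "distinct xs" "distinct ys" "set xs = set ys"
  shows "xs = ys"
  using assms(2-)
proof (induction xs arbitrary: ys)
  case Nil
  then show ?case by simp
next
  case (Cons x xs)
  obtain y ys' where ys: "ys = y # ys'" using Cons.prems by (cases ys) auto
  have "x = y"
  proof (rule ccontr)
    assume "x \<noteq> y"
    then have "x \<in> set ys'" "y \<in> set xs" using Cons.prems ys by auto
    then have "(x, y) \<in> r" "(y, x) \<in> r" using Cons.prems ys by auto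
    with assms(1) \<open>x \<noteq> y\<close> show False by (auto dest: antisymD)
  qed
  moreover have "set xs = set ys'" using Cons.prems ys \<open>x = y\<close> by auto
  ultimately show ?case using Cons ys by auto
qed

lemma sorted_wrt_exists:
  assumes "linear_order_on A r" "finite S" "S \<subseteq> A"
  shows "\<exists>xs. set xs = S \<and> distinct xs \<and> sorted_wrt (\<lambda>a b. (a, b) \<in> r) xs"
  using assms(2,3)
proof (induction S rule: finite_induct)
  case empty
  then show ?case by auto
next
  case (insert x S)
  then obtain xs where xs: "set xs = S" "distinct xs" "sorted_wrt (\<lambda>a b. (a, b) \<in> r) xs" by auto
  have tr: "trans r" and tot: "total_on A r"
    using assms(1) by (auto simp: order_on_defs)
  let ?P = "\<lambda>a. (a, x) \<in> r"
  let ?ys = "filter ?P xs @ x # filter (\<lambda>a. \<not> ?P a) xs"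
  have "(x, b) \<in> r" if "b \<in> S" "(b, x) \<notin> r" for b
    using that tot insert by (auto simp: total_on_def)
  moreover have "(a, b) \<in> r" if "(a, x) \<in> r" "(b, x) \<notin> r" "b \<in> S" for a b
    using that calculation tr by (meson transD)
  ultimately have "sorted_wrt (\<lambda>a b. (a, b) \<in> r) ?ys"
    using xs by (auto simp: sorted_wrt_append sorted_wrt_filter)
  moreover have "set ?ys = insert x S" "distinct ?ys" using xs insert by auto
  ultimately show ?case by blast
qed

lemma ordered_vertices:
  assumes "linear_order_on A r" "finite S" "S \<subseteq> A"
  shows "set (ordered_vertices r S) = S" "distinct (ordered_vertices r S)"
    "sorted_wrt (\<lambda>a b. (a, b) \<in> r) (ordered_vertices r S)"
proof -
  have "antisym r" using assms(1) by (auto simp: order_on_defs)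
  then have "\<exists>!vs. set vs = S \<and> distinct vs \<and> sorted_wrt (\<lambda>a b. (a, b) \<in> r) vs"
    using sorted_wrt_exists[OF assms] sorted_wrt_unique[of r] by blast
  from theI'[OF this] show "set (ordered_vertices r S) = S" "distinct (ordered_vertices r S)"
    "sorted_wrt (\<lambda>a b. (a, b) \<in> r) (ordered_vertices r S)"
    unfolding ordered_vertices_def by auto
qed

section \<open>Affine coordinates on a simplex and their gluing over the complex\<close>

lemma affine_coordinate:
  fixes S :: "'a::euclidean_space set"
  assumes "\<not> affine_dependent S" "v \<in> S"
  obtains f :: "'a \<Rightarrow> real" and a where "linear f" "\<And>w. w \<in> S \<Longrightarrow> f w + a = (if w = v then 1 else 0)"
proof (cases "S = {v}")
  case True
  then show ?thesis using that[of "\<lambda>_. 0" 1] by (auto simp: linear_iff)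
next
  case False
  then obtain z where z: "z \<in> S" "z \<noteq> v" using assms by auto
  have "independent ((\<lambda>x. x - z) ` (S - {z}))"
    using assms(1) z affine_dependent_iff_dependent[of z "S - {z}"]
    by (simp add: insert_absorb image_def)
  then obtain f :: "'a \<Rightarrow> real" where f: "linear f"
      "\<forall>x\<in>(\<lambda>x. x - z) ` (S - {z}). f x = (if x = v - z then 1 else 0)"
    using linear_independent_extend[of _ "\<lambda>x. if x = v - z then 1 else (0::real)"] by metis
  have "f w - f z = (if w = v then 1 else 0)" if "w \<in> S" for w
    using f(2) z that linear_diff[OF f(1), of w z] by (cases "w = z") auto
  then show ?thesis using that[OF f(1), of "- f z"] by auto
qed

lemma affine_coordinate_sum:
  fixes f :: "'a::euclidean_space \<Rightarrow> real"
  assumes "linear f" "\<And>w. w \<in> S \<Longrightarrow> f w + a = (if w = v then 1 else 0)" "finite S" "v \<in> S" "sum c S = 1"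
  shows "f (\<Sum>w\<in>S. c w *\<^sub>R w) + a = c v"
proof -
  have "f (\<Sum>w\<in>S. c w *\<^sub>R w) + a = (\<Sum>w\<in>S. c w * f w) + (\<Sum>w\<in>S. c w) * a"
    using assms by (simp add: linear_sum linear_scale)
  also have "\<dots> = (\<Sum>w\<in>S. c w * (f w + a))"
    by (simp add: sum.distrib sum_distrib_right distrib_left)
  also have "\<dots> = (\<Sum>w\<in>S. if w = v then c w else 0)"
    using assms(2) by (intro sum.cong) auto
  finally show ?thesis using assms by simp
qed

lemma affine_independent_coeffs_unique:
  fixes S :: "'a::euclidean_space set"
  assumes "\<not> affine_dependent S" "finite S" "sum c S = 1" "sum d S = 1"
    and "(\<Sum>w\<in>S. c w *\<^sub>R w) = (\<Sum>w\<in>S. d w *\<^sub>R w)" "v \<in> S"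
  shows "c v = d v"
proof -
  obtain f :: "'a \<Rightarrow> real" and a where f: "linear f" "\<And>w. w \<in> S \<Longrightarrow> f w + a = (if w = v then 1 else 0)"
    using affine_coordinate[OF assms(1,6)] by metis
  show ?thesis
    using affine_coordinate_sum[OF f assms(2,6,3)] affine_coordinate_sum[OF f assms(2,6,4)] assms(5)
    by simp
qed

definition is_bary :: "'a::euclidean_space set set \<Rightarrow> 'a \<Rightarrow> 'a set \<Rightarrow> ('a \<Rightarrow> real) \<Rightarrow> bool" where
  "is_bary K p S c \<longleftrightarrow> S \<in> K \<and> (\<forall>v\<in>S. 0 \<le> c v) \<and> (\<forall>v. v \<notin> S \<longrightarrow> c v = 0) \<and> sum c S = 1 \<and>
     (\<Sum>v\<in>S. c v *\<^sub>R v) = p"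

definition bary :: "'a::euclidean_space set set \<Rightarrow> 'a \<Rightarrow> 'a \<Rightarrow> real" where
  "bary K p = (SOME c. \<exists>S. is_bary K p S c)"

text \<open>The two hulls meet in the hull of \<open>S \<inter> T\<close>, so \<open>p\<close> also
  has coefficients supported there. Affine independence of \<open>S\<close> and of \<open>T\<close>
  identifies both \<open>c\<close> and \<open>d\<close> with these.\<close>

lemma is_bary_unique:
  assumes K: "simplicial_complex K" and c: "is_bary K p S c" and d: "is_bary K p T d"
  shows "c = d"
proof -
  have ST: "S \<in> K" "T \<in> K" "finite S" "finite T" "\<not> affine_dependent S" "\<not> affine_dependent T"
    using c d K by (auto simp: is_bary_def simplicial_complex_def)
  have "p \<in> convex hull S" "p \<in> convex hull T"
    using c d ST by (auto simp: is_bary_def convex_hull_finite)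
  then have "p \<in> convex hull (S \<inter> T)"
    using K ST(1,2) unfolding simplicial_complex_def by blast
  then obtain e where e: "\<forall>x\<in>S \<inter> T. 0 \<le> e x" "sum e (S \<inter> T) = 1" "(\<Sum>x\<in>S \<inter> T. e x *\<^sub>R x) = p"
    using ST by (auto simp: convex_hull_finite)
  define e' where "e' x = (if x \<in> S \<inter> T then e x else 0)" for x
  have eS: "sum e' S = 1" "(\<Sum>x\<in>S. e' x *\<^sub>R x) = p"
    using e ST sum.inter_restrict[of S e T] sum.inter_restrict[of S "\<lambda>x. e x *\<^sub>R x" T]
    by (auto simp: e'_def if_distrib[of "\<lambda>x. x *\<^sub>R _"] cong: if_cong)
  have eT: "sum e' T = 1" "(\<Sum>x\<in>T. e' x *\<^sub>R x) = p"
    using e ST sum.inter_restrict[of T e S] sum.inter_restrict[of T "\<lambda>x. e x *\<^sub>R x" S]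
    by (auto simp: e'_def Int_commute if_distrib[of "\<lambda>x. x *\<^sub>R _"] cong: if_cong)
  have "c v = e' v" for v
    using affine_independent_coeffs_unique[OF ST(5,3), of c e' v] c eS
    by (cases "v \<in> S") (auto simp: is_bary_def e'_def)
  moreover have "d v = e' v" for v
    using affine_independent_coeffs_unique[OF ST(6,4), of d e' v] d eT
    by (cases "v \<in> T") (auto simp: is_bary_def e'_def)
  ultimately show ?thesis by auto
qed

lemma bary_eq:
  assumes "simplicial_complex K" "is_bary K p S c"
  shows "bary K p = c"
  unfolding bary_def using assms is_bary_unique by (intro some_equality) blast+

lemma is_bary_bary:
  assumes "simplicial_complex K" "S \<in> K" "p \<in> convex hull S"
  shows "is_bary K p S (bary K p)"
proof -
  have "finite S" using assms by (auto simp: simplicial_complex_def)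
  then obtain c where c: "\<forall>x\<in>S. 0 \<le> c x" "sum c S = 1" "(\<Sum>x\<in>S. c x *\<^sub>R x) = p"
    using assms by (auto simp: convex_hull_finite)
  then have "is_bary K p S (\<lambda>v. if v \<in> S then c v else 0)"
    using assms by (auto simp: is_bary_def)
  with bary_eq[OF assms(1) this] show ?thesis by simp
qed

lemma bary_convex_comb:
  assumes K: "simplicial_complex K" "S \<in> K" and "finite I"
    and p: "\<And>i. i \<in> I \<Longrightarrow> p i \<in> convex hull S" and l: "\<And>i. i \<in> I \<Longrightarrow> 0 \<le> l i" "sum l I = 1"
  shows "bary K (\<Sum>i\<in>I. l i *\<^sub>R p i) v = (\<Sum>i\<in>I. l i * bary K (p i) v)"
proof -
  have b: "is_bary K (p i) S (bary K (p i))" if "i \<in> I" for i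
    using is_bary_bary K p that by blast
  have "is_bary K (\<Sum>i\<in>I. l i *\<^sub>R p i) S (\<lambda>v. \<Sum>i\<in>I. l i * bary K (p i) v)"
    unfolding is_bary_def
  proof (intro conjI allI impI ballI)
    show "S \<in> K" by fact
    show "0 \<le> (\<Sum>i\<in>I. l i * bary K (p i) v)" if "v \<in> S" for v
      using b l that by (intro sum_nonneg mult_nonneg_nonneg) (auto simp: is_bary_def)
    show "(\<Sum>i\<in>I. l i * bary K (p i) v) = 0" if "v \<notin> S" for v
      using b that by (intro sum.neutral) (auto simp: is_bary_def)
    have "(\<Sum>v\<in>S. \<Sum>i\<in>I. l i * bary K (p i) v) = (\<Sum>i\<in>I. l i * (\<Sum>v\<in>S. bary K (p i) v))"
      unfolding sum_distrib_left by (rule sum.swap)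
    also have "\<dots> = 1" using b l by (simp add: is_bary_def)
    finally show "(\<Sum>v\<in>S. \<Sum>i\<in>I. l i * bary K (p i) v) = 1" .
    have "(\<Sum>v\<in>S. (\<Sum>i\<in>I. l i * bary K (p i) v) *\<^sub>R v) = (\<Sum>i\<in>I. l i *\<^sub>R (\<Sum>v\<in>S. bary K (p i) v *\<^sub>R v))"
      unfolding scaleR_sum_right scaleR_sum_left scaleR_scaleR by (rule sum.swap)
    also have "\<dots> = (\<Sum>i\<in>I. l i *\<^sub>R p i)" using b by (intro sum.cong) (auto simp: is_bary_def)
    finally show "(\<Sum>v\<in>S. (\<Sum>i\<in>I. l i * bary K (p i) v) *\<^sub>R v) = (\<Sum>i\<in>I. l i *\<^sub>R p i)" .
  qed
  from bary_eq[OF K(1) this] show ?thesis by simp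
qed

text \<open>Gluing over finitely many closed simplices: on each of them the coordinate is zero or an
  affine function, and the pieces agree on overlaps because \<open>bary\<close> does not refer to a
  simplex.\<close>

lemma continuous_on_bary:
  assumes K: "simplicial_complex K" "finite K"
  shows "continuous_on (polyhedron K) (\<lambda>p. bary K p v)"
  unfolding polyhedron_def
proof (rule continuous_on_closed_Union)
  fix S assume S: "S \<in> K"
  have fin: "finite S" "\<not> affine_dependent S" using K S by (auto simp: simplicial_complex_def)
  show "closed (convex hull S)"
    using fin by (simp add: compact_imp_closed finite_imp_compact_convex_hull)
  show "continuous_on (convex hull S) (\<lambda>p. bary K p v)"
  proof (cases "v \<in> S")
    case False
    then have "bary K p v = 0" if "p \<in> convex hull S" for p
      using is_bary_bary[OF K(1) S that] by (simp add: is_bary_def)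
    then show ?thesis by (simp cong: continuous_on_cong)
  next
    case True
    obtain f :: "'a \<Rightarrow> real" and a where f: "linear f" "\<And>w. w \<in> S \<Longrightarrow> f w + a = (if w = v then 1 else 0)"
      using affine_coordinate[OF fin(2) True] by metis
    have "bary K p v = f p + a" if "p \<in> convex hull S" for p
      using is_bary_bary[OF K(1) S that] affine_coordinate_sum[OF f fin(1) True, of "bary K p"]
      by (simp add: is_bary_def)
    moreover have "continuous_on (convex hull S) (\<lambda>p. f p + a)"
      by (intro continuous_intros linear_continuous_on linear_conv_bounded_linear[THEN iffD1] f(1))
    ultimately show ?thesis by (simp cong: continuous_on_cong)
  qed
qed (fact K)

section \<open>The hat function of the cube triangulation\<close>

text \<open>One minus the spread of the coordinates together with an extra coordinate 0, cut off at
  0. This is the nodal function of the Kuhn (Freudenthal) triangulation. Maxima ignore repetitions,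
  so coordinates may be listed several times.\<close>

definition hat :: "'v set \<Rightarrow> ('v \<Rightarrow> real) \<Rightarrow> real" where
  "hat V d = max 0 (1 - Max (insert 0 (d ` V)) - Max (insert 0 ((\<lambda>v. - d v) ` V)))"

lemma continuous_on_Max_insert:
  fixes f :: "'v \<Rightarrow> 'a::topological_space \<Rightarrow> real"
  assumes "finite V" "\<And>v. v \<in> V \<Longrightarrow> continuous_on A (f v)"
  shows "continuous_on A (\<lambda>x. Max (insert 0 ((\<lambda>v. f v x) ` V)))"
  using assms
proof (induction V rule: finite_induct)
  case empty
  then show ?case by simp
next
  case (insert v V)
  have "Max (insert 0 ((\<lambda>v. f v x) ` insert v V)) = max (f v x) (Max (insert 0 ((\<lambda>v. f v x) ` V)))" for x
    using insert(1) Max_insert[of "insert 0 ((\<lambda>v. f v x) ` V)" "f v x"] by (simp only: image_insert insert_commute) simp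
  then show ?case using insert by (auto intro!: continuous_on_max)
qed

lemma continuous_on_hat:
  assumes "finite V" "\<And>v. v \<in> V \<Longrightarrow> continuous_on A (\<lambda>x. d x v)"
  shows "continuous_on A (\<lambda>x. hat V (d x))"
  unfolding hat_def
  by (intro continuous_on_max continuous_on_diff continuous_on_const
      continuous_on_Max_insert[OF assms(1)] continuous_on_minus assms(2))

lemma hat_eq:
  assumes "finite V" "0 \<le> M" "0 \<le> N" "M + N \<le> 1"
    and "\<And>v. v \<in> V \<Longrightarrow> d v \<le> M" "\<And>v. v \<in> V \<Longrightarrow> - N \<le> d v"
    and "M = 0 \<or> (\<exists>v\<in>V. d v = M)" "N = 0 \<or> (\<exists>v\<in>V. d v = - N)"
  shows "hat V d = 1 - M - N"
proof -
  have "Max (insert 0 (d ` V)) = M" using assms(1,2,5,7) by (intro Max_eqI) auto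
  moreover have "Max (insert 0 ((\<lambda>v. - d v) ` V)) = N"
  proof (intro Max_eqI)
    show "N \<in> insert 0 ((\<lambda>v. - d v) ` V)"
    proof (cases "N = 0")
      case False
      then obtain v where v: "v \<in> V" "d v = - N" using assms(8) by auto
      then have "N = - d v" by simp
      with v(1) show ?thesis by blast
    qed simp
    show "y \<le> N" if "y \<in> insert 0 ((\<lambda>v. - d v) ` V)" for y
      using that assms(3) assms(6)[THEN minus_le_iff[THEN iffD1]] by (auto simp: minus_le_iff)
  qed (use assms(1) in auto)
  ultimately show ?thesis using assms(4) by (simp add: hat_def)
qed

text \<open>In the coordinates of the cube, the vertices of a crystalline simplex form a chain of lattice points:
  the \<open>k\<close>-th one exceeds the last one by the indicator function of \<open>{v. k \<le> \<kappa> v}\<close>.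
  \<open>hat\<close> is the nodal function at the origin of the resulting triangulation.\<close>

lemma hat_chain_vertex:
  fixes \<kappa> :: "'v \<Rightarrow> nat"
  assumes "finite V" "{1..m} \<subseteq> \<kappa> ` V" "\<And>v. v \<in> V \<Longrightarrow> \<kappa> v \<le> m"
    and NN: "\<And>k. k \<in> {1..m+1} \<Longrightarrow> 0 \<le> c k" and one: "sum c {1..m+1} = (1::real)" and k: "k \<in> {1..m+1}"
  shows "hat V (\<lambda>v. sum c {1..\<kappa> v} - (if k \<le> \<kappa> v then 1 else 0)) = c k"
proof -
  define C where "C (j::nat) = sum c {1..j}" for j
  have mono: "C i \<le> C j" if "i \<le> j" "j \<le> m+1" for i j
    unfolding C_def
    by (rule sum_mono2) (use that NN in auto)
  have C: "C 0 = 0" "C (m+1) = 1" using one by (auto simp: C_def)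
  have Ck: "C k = C (k-1) + c k" using k unfolding C_def by (cases k) auto
  \<comment> \<open>The partial sums \<open>C\<close> increase. Coordinates with
    \<open>\<kappa> v < k\<close> give positive parts up to \<open>C (k-1)\<close>, those with
    \<open>k \<le> \<kappa> v\<close> negative parts down to \<open>C k - 1\<close>. Both extremes
    are attained by surjectivity of \<open>\<kappa>\<close> onto \<open>{1..m}\<close>, or are 0
    when \<open>k = 1\<close> or \<open>k = m+1\<close>.\<close>
  have "hat V (\<lambda>v. C (\<kappa> v) - (if k \<le> \<kappa> v then 1 else 0)) = 1 - C (k-1) - (1 - C k)"
  proof (rule hat_eq)
    show "finite V" by fact
    show "0 \<le> C (k-1)" "0 \<le> 1 - C k" "C (k-1) + (1 - C k) \<le> 1"
      using mono[of 0 "k-1"] mono[of k "m+1"] mono[of "k-1" k] C k by auto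
    fix v assume v: "v \<in> V"
    have "\<kappa> v \<le> m" using assms v by auto
    then show "C (\<kappa> v) - (if k \<le> \<kappa> v then 1 else 0) \<le> C (k-1)"
    proof (cases "k \<le> \<kappa> v")
      case True
      have "C (\<kappa> v) \<le> C (m+1)" "C 0 \<le> C (k-1)" using mono k \<open>\<kappa> v \<le> m\<close> by auto
      with True C show ?thesis by simp
    next
      case False
      then show ?thesis using mono[of "\<kappa> v" "k-1"] k by simp
    qed
    show "- (1 - C k) \<le> C (\<kappa> v) - (if k \<le> \<kappa> v then 1 else 0)"
      using mono[of k "\<kappa> v"] mono[of 0 "\<kappa> v"] mono[of k "m+1"] C k \<open>\<kappa> v \<le> m\<close> by (auto split: if_splits)
  next
    show "C (k-1) = 0 \<or> (\<exists>v\<in>V. C (\<kappa> v) - (if k \<le> \<kappa> v then 1 else 0) = C (k-1))"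
    proof (cases "k = 1")
      case False
      then have "k - 1 \<in> {1..m}" using k by auto
      then obtain v where "v \<in> V" "\<kappa> v = k - 1" using assms by force
      then show ?thesis using k by (intro disjI2 bexI[of _ v]) auto
    qed (use C in auto)
    show "1 - C k = 0 \<or> (\<exists>v\<in>V. C (\<kappa> v) - (if k \<le> \<kappa> v then 1 else 0) = - (1 - C k))"
    proof (cases "k = m+1")
      case False
      then have "k \<in> {1..m}" using k by auto
      then obtain v where "v \<in> V" "\<kappa> v = k" using assms by force
      then show ?thesis using k by (intro disjI2 bexI[of _ v]) auto
    qed (use C in auto)
  qed
  then show ?thesis using Ck unfolding C_def by simp
qed

text \<open>A nonzero value means \<open>M + N < 1\<close>, where \<open>M\<close> and
  \<open>N\<close> bound the deviations above and below. Each integer \<open>z v\<close> then lies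
  in an interval of length below 1 around \<open>C (\<kappa> v)\<close>, which leaves only 0 or 1,
  and monotonicity of \<open>C\<close> turns the choice into a threshold on
  \<open>\<kappa> v\<close>.\<close>

lemma hat_chain_support:
  fixes \<kappa> :: "'v \<Rightarrow> nat"
  assumes "finite V" "\<And>v. v \<in> V \<Longrightarrow> \<kappa> v \<le> m"
    and NN: "\<And>k. k \<in> {1..m+1} \<Longrightarrow> 0 \<le> c k" and one: "sum c {1..m+1} = (1::real)"
    and z: "\<And>v. v \<in> V \<Longrightarrow> z v \<in> \<int>" and nz: "hat V (\<lambda>v. sum c {1..\<kappa> v} - z v) \<noteq> 0"
  obtains k where "k \<in> {1..m+1}" "\<And>v. v \<in> V \<Longrightarrow> z v = (if k \<le> \<kappa> v then 1 else 0)"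
proof -
  define C where "C (j::nat) = sum c {1..j}" for j
  have mono: "C i \<le> C j" if "i \<le> j" "j \<le> m+1" for i j
    unfolding C_def
    by (rule sum_mono2) (use that NN in auto)
  have C: "C 0 = 0" "C (m+1) = 1" using one by (auto simp: C_def)
  define M N where "M = Max (insert 0 ((\<lambda>v. C (\<kappa> v) - z v) ` V))"
    and "N = Max (insert 0 ((\<lambda>v. - (C (\<kappa> v) - z v)) ` V))"
  have MN: "0 \<le> M" "0 \<le> N" "M + N < 1" and b: "\<And>v. v \<in> V \<Longrightarrow> C (\<kappa> v) - z v \<le> M"
     "\<And>v. v \<in> V \<Longrightarrow> - (C (\<kappa> v) - z v) \<le> N"
  proof -
    have "hat V (\<lambda>v. C (\<kappa> v) - z v) \<noteq> 0" using nz unfolding C_def .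
    then show "M + N < 1" unfolding hat_def M_def N_def by (rule contrapos_np) (simp add: max_def)
  qed (use assms(1) in \<open>auto simp: M_def N_def intro: Max_ge\<close>)
  \<comment> \<open>From \<open>C (\<kappa> v) \<ge> 1 - N\<close> on, the lower bound
    \<open>C (\<kappa> v) - M\<close> is positive and forces \<open>z v = 1\<close>; before that,
    the upper bound \<open>C (\<kappa> v) + N\<close> is below 1 and forces
    \<open>z v = 0\<close>.\<close>
  define k where "k = (LEAST k. C k \<ge> 1 - N)"
  have "C (m+1) \<ge> 1 - N" using C MN by auto
  then have k1: "C k \<ge> 1 - N" "k \<le> m+1" unfolding k_def by (auto intro: LeastI Least_le)
  have kleast: "C j < 1 - N" if "j < k" for j using not_less_Least that unfolding k_def by force
  have "k \<noteq> 0" using k1 C MN by (intro notI) auto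
  show ?thesis
  proof (rule that[of k])
    show "k \<in> {1..m+1}" using k1 \<open>k \<noteq> 0\<close> by auto
    fix v assume v: "v \<in> V"
    obtain n :: int where n: "z v = of_int n" using z[OF v] by (auto elim: Ints_cases)
    have kv: "\<kappa> v \<le> m" using assms v by auto
    have bb: "0 \<le> C (\<kappa> v)" "C (\<kappa> v) \<le> 1" using mono[of 0 "\<kappa> v"] mono[of "\<kappa> v" "m+1"] C kv by auto
    show "z v = (if k \<le> \<kappa> v then 1 else 0)"
    proof (cases "k \<le> \<kappa> v")
      case True
      then have "C (\<kappa> v) \<ge> 1 - N" using mono[of k "\<kappa> v"] k1 kv by auto
      then have "0 < real_of_int n" "real_of_int n < 2" using b[OF v] n MN bb by auto
      then have "n = 1" by linarith
      with True n show ?thesis by simp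
    next
      case False
      then have "C (\<kappa> v) < 1 - N" using kleast by auto
      then have "-1 < real_of_int n" "real_of_int n < 1" using b[OF v] n MN bb by auto
      then have "n = 0" by linarith
      with False n show ?thesis by simp
    qed
  qed
qed

section \<open>Slopes and the jiggling of one colour after the other\<close>

text \<open>The linear part of the affine interpolation of \<open>y\<close> on the vertices
  \<open>U\<close>, normalised by membership in \<open>slopes S\<close>. For crystalline cells,
  existence is shown separately and uniqueness comes from the norm bound with
  \<open>e = 0\<close>.\<close>

definition chord_slope :: "'a::euclidean_space set \<Rightarrow> 'a set \<Rightarrow> ('a \<Rightarrow> 'b::euclidean_space) \<Rightarrow> ('a \<Rightarrow>\<^sub>L 'b) \<Rightarrow> bool" where
  "chord_slope S U y L \<longleftrightarrow> L \<in> slopes S \<and> (\<forall>u\<in>U. \<forall>w\<in>U. L (u - w) = y u - y w)"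

lemma slopes_diff: "A \<in> slopes S \<Longrightarrow> B \<in> slopes S \<Longrightarrow> A - B \<in> slopes S"
  by (auto simp: slopes_def blinfun.diff_left)

lemma closed_slopes: "closed (slopes S :: ('a::euclidean_space \<Rightarrow>\<^sub>L 'b::euclidean_space) set)"
proof -
  have "(slopes S :: ('a \<Rightarrow>\<^sub>L 'b) set) = (\<Inter>w\<in>{w. \<forall>u\<in>tangent_space S. inner w u = 0}. {L. blinfun_apply L w = 0})"
    by (auto simp: slopes_def)
  moreover have "closed {L :: 'a \<Rightarrow>\<^sub>L 'b. blinfun_apply L w = 0}" for w
    by (intro closed_Collect_eq continuous_intros)
  ultimately show ?thesis by (simp add: closed_INT)
qed

text \<open>\<open>\<times>\<close> binds more tightly than \<open>hull\<close>, so the definition of \<open>jet_space\<close>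
  reads \<open>convex hull (S \<times> UNIV \<times> slopes S)\<close>.\<close>

lemma jet_space_eq:
  "(jet_space S :: ('a::euclidean_space \<times> 'b::euclidean_space \<times> ('a \<Rightarrow>\<^sub>L 'b)) set)
    = (convex hull S) \<times> UNIV \<times> slopes S"
proof -
  have "convex (slopes S :: ('a \<Rightarrow>\<^sub>L 'b) set)"
    by (auto simp: convex_def slopes_def blinfun.add_left blinfun.scaleR_left)
  then show ?thesis
    by (simp add: jet_space_def convex_hull_Times hull_same)
qed

lemma chord_slope_diff:
  "chord_slope S U y L \<Longrightarrow> chord_slope S U y' L' \<Longrightarrow> chord_slope S U (\<lambda>p. y p - y' p) (L - L')"
  by (auto simp: chord_slope_def slopes_diff blinfun.diff_left algebra_simps)

text \<open>A lower bound for the distance to the complement of the relation. Base point and value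
  get room as well as the slope, so that one jet at a vertex can account for every point of a small
  cell.\<close>

definition deep :: "('a::euclidean_space \<times> 'b::euclidean_space \<times> ('a \<Rightarrow>\<^sub>L 'b)) set \<Rightarrow> 'a set \<Rightarrow> real \<Rightarrow> 'a \<Rightarrow> 'b \<Rightarrow> ('a \<Rightarrow>\<^sub>L 'b) \<Rightarrow> bool" where
  "deep R S r x y L \<longleftrightarrow> (\<forall>x'\<in>convex hull S. \<forall>y'. \<forall>L'\<in>slopes S.
     dist x' x < r \<and> dist y' y < r \<and> dist L' L < r \<longrightarrow> (x', y', L') \<in> R)"

lemma deep_mono: "deep R S r x y L \<Longrightarrow> r' \<le> r \<Longrightarrow> deep R S r' x y L"
  unfolding deep_def by (meson less_le_trans)

lemma deep_perturb: "deep R S r x y L \<Longrightarrow> dist L' L \<le> r / 2 \<Longrightarrow> deep R S (r / 2) x y L'"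
  unfolding deep_def
proof (intro ballI allI impI)
  fix x' y' L'' assume *: "\<forall>x'\<in>convex hull S. \<forall>y'. \<forall>L'\<in>slopes S.
     dist x' x < r \<and> dist y' y < r \<and> dist L' L < r \<longrightarrow> (x', y', L') \<in> R" "dist L' L \<le> r / 2"
   "x' \<in> convex hull S" "L'' \<in> slopes S" "dist x' x < r / 2 \<and> dist y' y < r / 2 \<and> dist L'' L' < r / 2"
  have "dist L'' L < r" using *(2,5)
    by (smt (verit) dist_triangle field_sum_of_halves)
  moreover have "dist x' x < r" "dist y' y < r" using *(5) zero_le_dist[of x' x] zero_le_dist[of y' y] by linarith+
  ultimately show "(x', y', L'') \<in> R" using * by blast
qed

text \<open>A minimum over a finite subcover. The local radius serves both as size of the
  neighbourhood and as the parameter of \<open>P\<close>, which is harmless because \<open>P\<close>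
  survives shrinking of the parameter.\<close>

lemma compact_uniform_radius:
  fixes Q :: "'q::metric_space set" and P :: "real \<Rightarrow> 'q \<Rightarrow> bool"
  assumes "compact Q" and anti: "\<And>r r' q. P r q \<Longrightarrow> 0 < r' \<Longrightarrow> r' \<le> r \<Longrightarrow> P r' q"
    and loc: "\<And>q. q \<in> Q \<Longrightarrow> \<exists>r>0. \<forall>q'\<in>Q. dist q q' < r \<longrightarrow> P r q'"
  shows "\<exists>r>0. \<forall>q\<in>Q. P r q"
proof -
  obtain \<rho> where \<rho>: "\<And>q. q \<in> Q \<Longrightarrow> \<rho> q > 0 \<and> (\<forall>q'\<in>Q. dist q q' < \<rho> q \<longrightarrow> P (\<rho> q) q')"
    using loc by metis
  have "Q \<subseteq> (\<Union>q\<in>Q. ball q (\<rho> q))" using \<rho> by force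
  with \<open>compact Q\<close> obtain T where T: "T \<subseteq> Q" "finite T" "Q \<subseteq> (\<Union>q\<in>T. ball q (\<rho> q))"
    using compactE_image[of Q Q "\<lambda>q. ball q (\<rho> q)"] by blast
  define r where "r = Min (insert 1 (\<rho> ` T))"
  have r: "r > 0" "\<And>q. q \<in> T \<Longrightarrow> r \<le> \<rho> q" using T \<rho> by (auto simp: r_def)
  have "P r q" if q: "q \<in> Q" for q
  proof -
    obtain q' where q': "q' \<in> T" "dist q' q < \<rho> q'" using T(3) q by auto
    then have "P (\<rho> q') q" using \<rho> T q by blast
    then show ?thesis using anti r q' by blast
  qed
  with r show ?thesis by blast
qed

text \<open>Density supplies a slope \<open>A\<close> in the fibre over one jet, and by openness the
  same \<open>A\<close> works for all jets nearby. Bounding \<open>y\<close> and \<open>L\<close> by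
  \<open>B\<close> makes the set of jets compact, hence one radius for all.\<close>

lemma uniform_density:
  fixes R :: "('a::euclidean_space \<times> 'b::euclidean_space \<times> ('a \<Rightarrow>\<^sub>L 'b)) set"
  assumes "finite S" and R: "open_relation S R" "fiberwise_dense S R" and "\<delta> > 0"
  shows "\<exists>r>0. \<forall>x\<in>convex hull S. \<forall>y. \<forall>L\<in>slopes S. norm y \<le> B \<and> norm L \<le> B \<longrightarrow>
           (\<exists>L'\<in>slopes S. dist L' L < \<delta> \<and> deep R S r x y L')"
proof -
  define Q where "Q = (convex hull S) \<times> cball (0::'b) B \<times> (slopes S \<inter> cball (0::'a \<Rightarrow>\<^sub>L 'b) B)"
  define P where "P = (\<lambda>r (x, y, L). \<exists>L'\<in>slopes S. dist L' L < \<delta> \<and> deep R S r x y L')"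
  have "compact Q" unfolding Q_def
    by (intro compact_Times closed_Int_compact closed_slopes compact_cball
        finite_imp_compact_convex_hull \<open>finite S\<close>)
  moreover have "P r q \<Longrightarrow> r' \<le> r \<Longrightarrow> P r' q" for r r' q
    unfolding P_def by (cases q) (simp, blast intro: deep_mono)
  moreover have "\<exists>r>0. \<forall>q'\<in>Q. dist q q' < r \<longrightarrow> P r q'" if "q \<in> Q" for q
  proof -
    obtain x y L where q: "q = (x, y, L)" "x \<in> convex hull S" "L \<in> slopes S"
      using \<open>q \<in> Q\<close> by (auto simp: Q_def)
    then have "L \<in> closure {A. (x, y, A) \<in> R}" using R(2) by (auto simp: fiberwise_dense_def)
    then obtain A where A: "(x, y, A) \<in> R" "dist A L < \<delta> / 2"
      using \<open>\<delta> > 0\<close> by (auto simp: closure_approachable dest!: spec[of _ "\<delta>/2"])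
    have AS: "A \<in> slopes S" using A(1) R(1) by (auto simp: open_relation_def jet_space_eq)
    obtain e where e: "e > 0" "\<And>p. p \<in> jet_space S \<Longrightarrow> dist p (x, y, A) < e \<Longrightarrow> p \<in> R"
      using R(1) A(1) unfolding open_relation_def openin_euclidean_subtopology_iff by blast
    \<comment> \<open>Half of \<open>\<delta>\<close> is already spent on the distance from
      \<open>A\<close> to \<open>L\<close>. The jets to be caught deviate from
      \<open>(x, y, A)\<close> by less than \<open>2 * r\<close>, \<open>2 * r\<close> and
      \<open>r\<close>, in total less than \<open>e\<close>.\<close>
    define r where "r = min (\<delta> / 2) (e / 6)"
    have r: "r > 0" "r \<le> \<delta> / 2" "r \<le> e / 6" using e \<open>\<delta> > 0\<close> by (auto simp: r_def)
    have "P r (x1, y1, L1)" if d: "dist (x, y, L) (x1, y1, L1) < r" for x1 y1 L1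
    proof -
      have d': "dist x x1 < r" "dist y y1 < r" "dist L L1 < r"
        using d dist_fst_le[of "(x, y, L)" "(x1, y1, L1)"] dist_snd_le[of "(x, y, L)" "(x1, y1, L1)"]
          dist_fst_le[of "(y, L)" "(y1, L1)"] dist_snd_le[of "(y, L)" "(y1, L1)"] by auto
      have "dist A L1 < \<delta>" using dist_triangle[of A L1 L] d' A r by linarith
      moreover have "deep R S r x1 y1 A" unfolding deep_def
      proof (intro ballI allI impI)
        fix x' y' L' assume *: "x' \<in> convex hull S" "L' \<in> slopes S"
          "dist x' x1 < r \<and> dist y' y1 < r \<and> dist L' A < r"
        have "dist x' x < 2 * r" "dist y' y < 2 * r"
          using * d' dist_triangle[of x' x x1] dist_triangle[of y' y y1] by (auto simp: dist_commute)
        moreover have "dist (x', y', L') (x, y, A) \<le> dist x' x + (dist y' y + dist L' A)"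
          unfolding dist_prod_def fst_conv snd_conv
          by (intro order_trans[OF sqrt_sum_squares_le_sum] add_left_mono sqrt_sum_squares_le_sum) auto
        ultimately have "dist (x', y', L') (x, y, A) < e" using * r by linarith
        then show "(x', y', L') \<in> R" using e * by (auto simp: jet_space_eq)
      qed
      ultimately show ?thesis using AS by (auto simp: P_def)
    qed
    then show ?thesis using r(1) q(1) by (intro exI[of _ r]) auto
  qed
  ultimately obtain r where "r > 0" "\<forall>q\<in>Q. P r q"
    using compact_uniform_radius[of Q P] by blast
  then show ?thesis by (intro exI[of _ r]) (auto simp: Q_def P_def)
qed

text \<open>The radius is fixed before \<open>l\<close>, which is possible because the constants are
  scale free: displacements of order \<open>1 / 2 ^ l\<close> on cells of that size change slopes by
  amounts independent of \<open>l\<close>. Depth is tested at \<open>b U\<close> and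
  \<open>s (b U)\<close>, which no displacement alters. The induction treats all
  \<open>\<delta>\<close> at once, so that half of it can be left to the earlier colours.\<close>

lemma jiggle_colours:
  fixes cells :: "nat \<Rightarrow> ('k \<times> 'a::euclidean_space set) set" and \<Delta> :: "'k \<Rightarrow> 'a set"
    and R :: "'a set \<Rightarrow> ('a \<times> 'b::euclidean_space \<times> ('a \<Rightarrow>\<^sub>L 'b)) set" and s :: "'a \<Rightarrow> 'b"
    and b :: "'a set \<Rightarrow> 'a"
  assumes "finite F" and "C > 0"
    and dens: "\<And>k \<delta> B. k \<in> F \<Longrightarrow> \<delta> > 0 \<Longrightarrow> \<exists>r>0. \<forall>x\<in>convex hull \<Delta> k. \<forall>y. \<forall>L\<in>slopes (\<Delta> k).
           norm y \<le> B \<and> norm L \<le> B \<longrightarrow>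
           (\<exists>L'\<in>slopes (\<Delta> k). dist L' L < \<delta> \<and> deep (R (\<Delta> k)) (\<Delta> k) r x y L')"
    and base: "\<And>l k U. (k, U) \<in> cells l \<Longrightarrow> b U \<in> U"
    and cell: "\<And>l k U. (k, U) \<in> cells l \<Longrightarrow> U \<subseteq> convex hull \<Delta> k"
    and disj: "\<And>l k U U'. (k, U) \<in> cells l \<Longrightarrow> (k, U') \<in> cells l \<Longrightarrow> U \<inter> U' \<noteq> {} \<Longrightarrow> U = U'"
    and diam: "\<And>l k U u w. (k, U) \<in> cells l \<Longrightarrow> u \<in> U \<Longrightarrow> w \<in> U \<Longrightarrow> norm (u - w) \<le> C / 2 ^ l"
    and ex: "\<And>l k U y. (k, U) \<in> cells l \<Longrightarrow> \<exists>L. chord_slope (\<Delta> k) U (y :: 'a \<Rightarrow> 'b) L"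
    and bd: "\<And>l k U y L e. (k, U) \<in> cells l \<Longrightarrow> chord_slope (\<Delta> k) U (y :: 'a \<Rightarrow> 'b) L \<Longrightarrow>
           (\<And>u w. u \<in> U \<Longrightarrow> w \<in> U \<Longrightarrow> norm (y u - y w) \<le> e) \<Longrightarrow> norm L \<le> C * 2 ^ l * e"
    and sB: "\<And>l k U u. (k, U) \<in> cells l \<Longrightarrow> u \<in> U \<Longrightarrow> norm (s u) \<le> B"
    and LB: "\<And>l k U L. (k, U) \<in> cells l \<Longrightarrow> chord_slope (\<Delta> k) U s L \<Longrightarrow> norm L \<le> B"
    and "\<delta> > 0"
  shows "\<exists>r>0. \<forall>l. \<exists>y. (\<forall>p. norm (y p - s p) \<le> \<delta> / 2 ^ l) \<and>
     (\<forall>k\<in>F. \<forall>U L. (k, U) \<in> cells l \<longrightarrow> chord_slope (\<Delta> k) U y L \<longrightarrow>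
        deep (R (\<Delta> k)) (\<Delta> k) r (b U) (s (b U)) L)"
  using \<open>finite F\<close> dens \<open>\<delta> > 0\<close>
proof (induction F arbitrary: \<delta> rule: finite_induct)
  case empty
  have "\<forall>l. \<exists>y. \<forall>p. norm (y p - s p) \<le> \<delta> / 2 ^ l"
    using empty by (intro allI exI[of _ s]) auto
  then show ?case by (intro exI[of _ 1]) auto
next
  case (insert k F)
  obtain r0 where r0: "r0 > 0" "\<And>l. \<exists>y. (\<forall>p. norm (y p - s p) \<le> \<delta> / 2 / 2 ^ l) \<and>
     (\<forall>k\<in>F. \<forall>U L. (k, U) \<in> cells l \<longrightarrow> chord_slope (\<Delta> k) U y L \<longrightarrow>
        deep (R (\<Delta> k)) (\<Delta> k) r0 (b U) (s (b U)) L)"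
    using insert.IH[of "\<delta> / 2"] insert.prems by auto
  \<comment> \<open>The first bound keeps the new displacement \<open>\<eta> * C / 2 ^ l\<close>
    within the remaining half of \<open>\<delta> / 2 ^ l\<close>. The second keeps the slope change
    \<open>2 * C\<^sup>2 * \<eta>\<close> of the earlier colours within half of their depth
    \<open>r0\<close>.\<close>
  define \<eta> where "\<eta> = min (\<delta> / (2 * C)) (r0 / (4 * C\<^sup>2))"
  have \<eta>: "\<eta> > 0" "\<eta> * C \<le> \<delta> / 2" "2 * C\<^sup>2 * \<eta> \<le> r0 / 2"
  proof -
    show "\<eta> > 0" using r0 \<open>C > 0\<close> insert.prems by (auto simp: \<eta>_def)
    have "\<eta> \<le> \<delta> / (2 * C)" "\<eta> \<le> r0 / (4 * C\<^sup>2)" by (auto simp: \<eta>_def)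
    then show "\<eta> * C \<le> \<delta> / 2" "2 * C\<^sup>2 * \<eta> \<le> r0 / 2" using \<open>C > 0\<close> by (auto simp: field_simps)
  qed
  \<comment> \<open>The slopes to be corrected differ from those of \<open>s\<close> by at most
    \<open>C * 2 ^ l * (\<delta> / 2 ^ l)\<close>, whence the bound \<open>B + C * \<delta>\<close>.
    Since \<open>\<eta>\<close> does not involve \<open>l\<close>, neither does
    \<open>r1\<close>.\<close>
  obtain r1 where r1: "r1 > 0" "\<And>x y L. x \<in> convex hull \<Delta> k \<Longrightarrow> L \<in> slopes (\<Delta> k) \<Longrightarrow>
      norm y \<le> B + C * \<delta> \<Longrightarrow> norm L \<le> B + C * \<delta> \<Longrightarrow>
      \<exists>L'\<in>slopes (\<Delta> k). dist L' L < \<eta> \<and> deep (R (\<Delta> k)) (\<Delta> k) r1 x y L'"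
    using insert.prems(1)[of k \<eta> "B + C * \<delta>"] \<eta>(1) by auto
  define r where "r = min (r0 / 2) r1"
  have "\<exists>y. (\<forall>p. norm (y p - s p) \<le> \<delta> / 2 ^ l) \<and>
     (\<forall>k\<in>insert k F. \<forall>U L. (k, U) \<in> cells l \<longrightarrow> chord_slope (\<Delta> k) U y L \<longrightarrow>
        deep (R (\<Delta> k)) (\<Delta> k) r (b U) (s (b U)) L)" for l
  proof -
    obtain y where y: "\<And>p. norm (y p - s p) \<le> \<delta> / 2 / 2 ^ l"
      "\<And>k U L. k \<in> F \<Longrightarrow> (k, U) \<in> cells l \<Longrightarrow> chord_slope (\<Delta> k) U y L \<Longrightarrow>
        deep (R (\<Delta> k)) (\<Delta> k) r0 (b U) (s (b U)) L"
      using r0(2)[of l] by metis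
    have "\<exists>L L'. chord_slope (\<Delta> k) U y L \<and> L' \<in> slopes (\<Delta> k) \<and> dist L' L < \<eta> \<and>
        deep (R (\<Delta> k)) (\<Delta> k) r1 (b U) (s (b U)) L'" if U: "(k, U) \<in> cells l" for U
    proof -
      obtain L L0 where L: "chord_slope (\<Delta> k) U y L" "chord_slope (\<Delta> k) U s L0" using ex[OF U] by blast
      have "norm (L - L0) \<le> C * 2 ^ l * (\<delta> / 2 ^ l)"
      proof (rule bd[OF U chord_slope_diff[OF L]])
        fix u w
        have "norm (y u - s u - (y w - s w)) \<le> \<delta> / 2 / 2 ^ l + \<delta> / 2 / 2 ^ l"
          by (rule norm_triangle_le_diff[OF add_mono[OF y(1) y(1)]])
        then show "norm (y u - s u - (y w - s w)) \<le> \<delta> / 2 ^ l" by simp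
      qed
      then have "norm L \<le> B + C * \<delta>"
        using LB[OF U L(2)] norm_triangle_sub[of L L0] by simp
      moreover have "norm (s (b U)) \<le> B + C * \<delta>"
        using sB[OF U base[OF U]] \<open>C > 0\<close> insert.prems(2) by (smt (verit) mult_pos_pos)
      ultimately show ?thesis
        using r1(2)[of "b U" L "s (b U)"] cell[OF U] base[OF U] L(1) unfolding chord_slope_def by blast
    qed
    then obtain L0 L1 where L0: "\<And>U. (k, U) \<in> cells l \<Longrightarrow> chord_slope (\<Delta> k) U y (L0 U)"
      and L1: "\<And>U. (k, U) \<in> cells l \<Longrightarrow> L1 U \<in> slopes (\<Delta> k)"
         "\<And>U. (k, U) \<in> cells l \<Longrightarrow> dist (L1 U) (L0 U) < \<eta>"
         "\<And>U. (k, U) \<in> cells l \<Longrightarrow> deep (R (\<Delta> k)) (\<Delta> k) r1 (b U) (s (b U)) (L1 U)"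
      by metis
    \<comment> \<open>By \<open>disj\<close> a point belongs to at most one vertex set of colour
      \<open>k\<close>. There the values are replaced by the affine map of slope \<open>L1\<close>
      that keeps the value at the base vertex; all other points keep \<open>y\<close>.\<close>
    define cl where "cl p = (SOME U. (k, U) \<in> cells l \<and> p \<in> U)" for p
    define z where "z p = (if \<exists>U. (k, U) \<in> cells l \<and> p \<in> U then y (b (cl p)) + L1 (cl p) (p - b (cl p)) else y p)" for p
    have z_cell: "z p = y (b U) + L1 U (p - b U)" if "(k, U) \<in> cells l" "p \<in> U" for p U
    proof -
      have "(k, cl p) \<in> cells l \<and> p \<in> cl p" unfolding cl_def by (rule someI) (use that in blast)
      then have "cl p = U" using disj that by blast
      then show ?thesis using that by (auto simp: z_def)
    qed
    have zy: "norm (z p - y p) \<le> \<eta> * C / 2 ^ l" for p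
    proof (cases "\<exists>U. (k, U) \<in> cells l \<and> p \<in> U")
      case False
      then have "z p = y p" unfolding z_def by (rule if_not_P)
      then show ?thesis using \<eta>(1) \<open>C > 0\<close> by simp
    next
      case True
      then obtain U where U: "(k, U) \<in> cells l" "p \<in> U" by blast
      \<comment> \<open>The old values on the cell come from the slope \<open>L0 U\<close>, so the
        displacement is the difference of the two slopes applied to a vector bounded by the
        diameter.\<close>
      have "y p - y (b U) = L0 U (p - b U)" using L0[OF U(1)] U(2) base[OF U(1)] by (simp add: chord_slope_def)
      then have "z p - y p = (L1 U - L0 U) (p - b U)"
        unfolding z_cell[OF U] by (simp add: blinfun.diff_left algebra_simps)
      then have "norm (z p - y p) \<le> norm (L1 U - L0 U) * norm (p - b U)"
        using norm_blinfun by metis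
      also have "\<dots> \<le> \<eta> * (C / 2 ^ l)"
        using L1(2)[OF U(1)] diam[OF U(1,2) base[OF U(1)]] \<eta>(1)
        by (intro mult_mono) (auto simp: dist_norm)
      finally show ?thesis by simp
    qed
    show ?thesis
    proof (intro exI[of _ z] conjI allI ballI impI)
      fix p
      have "norm (z p - s p) \<le> \<eta> * C / 2 ^ l + \<delta> / 2 / 2 ^ l"
        using norm_triangle_mono[OF zy[of p] y(1)[of p]] by simp
      also have "\<dots> \<le> (\<delta> / 2) / 2 ^ l + \<delta> / 2 / 2 ^ l"
        using \<eta>(2) by (intro add_right_mono divide_right_mono) auto
      finally show "norm (z p - s p) \<le> \<delta> / 2 ^ l" by simp
    next
      fix k' U L assume k': "k' \<in> insert k F" and U: "(k', U) \<in> cells l" and L: "chord_slope (\<Delta> k') U z L"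
      show "deep (R (\<Delta> k')) (\<Delta> k') r (b U) (s (b U)) L"
      proof (cases "k' = k")
        case True
        have "chord_slope (\<Delta> k) U z (L1 U)"
          using L1(1) U True z_cell
          by (auto simp: chord_slope_def blinfun.diff_right)
        \<comment> \<open>With \<open>e = 0\<close> the slope bound becomes uniqueness of the chord
          slope.\<close>
        from chord_slope_diff[OF L[unfolded True] this] have "norm (L - L1 U) \<le> C * 2 ^ l * 0"
          using U True by (intro bd) auto
        then have "L = L1 U" by simp
        then show ?thesis using L1(3)[of U] U True deep_mono[of _ _ r1 _ _ _ r] by (auto simp: r_def)
      next
        case False
        obtain L' where L': "chord_slope (\<Delta> k') U y L'" using ex[OF U] by blast
        have "norm (L - L') \<le> C * 2 ^ l * (2 * \<eta> * C / 2 ^ l)"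
        proof (rule bd[OF U chord_slope_diff[OF L L']])
          fix u w
          have "norm (z u - y u - (z w - y w)) \<le> \<eta> * C / 2 ^ l + \<eta> * C / 2 ^ l"
            by (rule norm_triangle_le_diff[OF add_mono[OF zy zy]])
          then show "norm (z u - y u - (z w - y w)) \<le> 2 * \<eta> * C / 2 ^ l" by (simp add: mult_ac)
        qed
        then have "dist L L' \<le> r0 / 2" using \<eta>(3) by (simp add: dist_norm power2_eq_square mult_ac)
        then have "deep (R (\<Delta> k')) (\<Delta> k') (r0 / 2) (b U) (s (b U)) L"
          using y(2)[OF _ U L'] k' False by (intro deep_perturb) auto
        then show ?thesis by (rule deep_mono) (simp add: r_def)
      qed
    qed
  qed
  moreover have "r > 0" using r0 r1 by (simp add: r_def)
  ultimately show ?case by blast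
qed

section \<open>Uniform linearisation\<close>

text \<open>Smoothness makes every directional derivative \<open>iter_dderiv g [v]\<close>
  differentiable, hence continuous; in finite dimension this gives continuity of the derivative in
  operator norm.\<close>

lemma smooth_on_set_derivative:
  fixes f :: "'a::euclidean_space \<Rightarrow> 'b::euclidean_space"
  assumes "smooth_on_set X f"
  obtains D :: "'a \<Rightarrow> 'a \<Rightarrow>\<^sub>L 'b" where "\<And>x. x \<in> X \<Longrightarrow> (f has_derivative D x) (at x within X)" "continuous_on X D"
proof -
  obtain U g where U: "X \<subseteq> U" "C_infinity_on U g" "\<And>x. x \<in> X \<Longrightarrow> g x = f x"
    using assms by (auto simp: smooth_on_set_def)
  have "open U" and d: "\<And>vs. iter_dderiv g vs differentiable_on U" using U(2) by (auto simp: C_infinity_on_def)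
  define D where "D x = Blinfun (frechet_derivative g (at x))" for x
  have der: "(g has_derivative frechet_derivative g (at x)) (at x)" if "x \<in> U" for x
    using d[of "[]"] that \<open>open U\<close> by (simp add: differentiable_on_eq_differentiable_at frechet_derivative_works)
  then have D: "blinfun_apply (D x) = frechet_derivative g (at x)" if "x \<in> U" for x
    using that has_derivative_bounded_linear unfolding D_def by (intro bounded_linear_Blinfun_apply) blast
  show ?thesis
  proof (rule that[of D])
    fix x assume x: "x \<in> X"
    then have "(g has_derivative D x) (at x)" using der[of x] D[of x] U(1) by auto
    then have "(g has_derivative D x) (at x within X)" by (rule has_derivative_at_withinI)
    then show "(f has_derivative D x) (at x within X)"
      by (rule has_derivative_transform[OF x, rotated]) (simp add: U(3))
  next
    have "continuous_on U (\<lambda>x. D x v)" for v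
      using differentiable_imp_continuous_on[OF d[of "[v]"]] D by (simp cong: continuous_on_cong)
    then have "continuous_on U D" by (intro continuous_on_blinfun_componentwise)
    then show "continuous_on X D" using U(1) continuous_on_subset by blast
  qed
qed

text \<open>The mean value inequality for \<open>f - D x\<close> on the convex set
  \<open>X \<inter> ball x \<rho>\<close>. The derivative is frozen at a third point
  \<open>x\<close> because the chord slope of a cell is later compared with the derivative at an
  arbitrary point of it.\<close>

lemma uniform_linearization:
  fixes f :: "'a::euclidean_space \<Rightarrow> 'b::euclidean_space" and D :: "'a \<Rightarrow> 'a \<Rightarrow>\<^sub>L 'b"
  assumes "compact X" "convex X" and der: "\<And>x. x \<in> X \<Longrightarrow> (f has_derivative D x) (at x within X)"
    and "continuous_on X D" "\<eta> > 0"
  shows "\<exists>\<rho>>0. \<forall>x\<in>X. \<forall>u\<in>X. \<forall>w\<in>X. dist x u < \<rho> \<and> dist x w < \<rho> \<longrightarrow>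
           norm (f u - f w - D x (u - w)) \<le> \<eta> * norm (u - w)"
proof -
  have "uniformly_continuous_on X D" using assms by (intro compact_uniformly_continuous)
  then obtain \<rho> where \<rho>: "\<rho> > 0" "\<And>x x'. x \<in> X \<Longrightarrow> x' \<in> X \<Longrightarrow> dist x' x < \<rho> \<Longrightarrow> dist (D x') (D x) < \<eta>"
    using \<open>\<eta> > 0\<close> unfolding uniformly_continuous_on_def by metis
  have "norm (f u - f w - D x (u - w)) \<le> \<eta> * norm (u - w)"
    if x: "x \<in> X" "u \<in> X" "w \<in> X" "dist x u < \<rho>" "dist x w < \<rho>" for x u w
  proof -
    let ?Y = "X \<inter> ball x \<rho>"
    have "norm ((f u - D x u) - (f w - D x w)) \<le> \<eta> * norm (u - w)"
    proof (rule differentiable_bound[where S = ?Y and f' = "\<lambda>z. blinfun_apply (D z - D x)"])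
      show "convex ?Y" using \<open>convex X\<close> by (intro convex_Int) auto
      show "u \<in> ?Y" "w \<in> ?Y" using x by auto
      fix z assume z: "z \<in> ?Y"
      have "(f has_derivative D z) (at z within ?Y)"
        using der[of z] z has_derivative_subset by blast
      then show "((\<lambda>z. f z - D x z) has_derivative (D z - D x)) (at z within ?Y)"
        by (simp add: blinfun.diff_left[abs_def] has_derivative_diff bounded_linear_imp_has_derivative
            blinfun.bounded_linear_right)
      show "onorm (blinfun_apply (D z - D x)) \<le> \<eta>"
        using \<rho>(2)[of x z] z x by (auto simp: norm_blinfun.rep_eq[symmetric] dist_norm norm_minus_commute)
    qed
    then show ?thesis by (simp add: blinfun.diff_right algebra_simps)
  qed
  with \<rho>(1) show ?thesis by blast
qed

section \<open>Geometry of the crystalline simplices\<close>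

lemma abel_summation:
  fixes X :: "nat \<Rightarrow> real" and v :: "nat \<Rightarrow> 'a::real_vector"
  shows "(\<Sum>j<Suc n. (X (j + 1) - X j) *\<^sub>R v j) =
    X (n + 1) *\<^sub>R v n - X 0 *\<^sub>R v 0 + (\<Sum>i=1..n. X i *\<^sub>R (v (i - 1) - v i))"
  by (induction n) (auto simp: algebra_simps)

text \<open>Summation by parts turns differences of coordinates into coefficients of edge vectors.
  In this form \<open>iota_inv\<close> is visibly affine, each cube coordinate moving along one
  edge.\<close>

lemma iota_inv_eq:
  assumes "length vs = m + 1"
  shows "iota_inv vs x = vs ! m + (\<Sum>i=1..m. x i *\<^sub>R (vs ! (i - 1) - vs ! i))"
proof -
  have "iota_inv vs x = ext_coord m x (m + 1) *\<^sub>R vs ! m - ext_coord m x 0 *\<^sub>R vs ! 0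
      + (\<Sum>i=1..m. ext_coord m x i *\<^sub>R (vs ! (i - 1) - vs ! i))"
    using abel_summation[of "ext_coord m x" "\<lambda>j. vs ! j" m] assms by (simp add: iota_inv_def)
  also have "(\<Sum>i=1..m. ext_coord m x i *\<^sub>R (vs ! (i - 1) - vs ! i)) = (\<Sum>i=1..m. x i *\<^sub>R (vs ! (i - 1) - vs ! i))"
    by (intro sum.cong) (auto simp: ext_coord_def)
  finally show ?thesis by (simp add: ext_coord_def)
qed

lemma iota_inv_cong:
  assumes "length vs = m + 1" "\<And>i. i \<in> {1..m} \<Longrightarrow> x i = y i"
  shows "iota_inv vs x = iota_inv vs y"
  unfolding iota_inv_eq[OF assms(1)] using assms(2) by (intro arg_cong2[where f="(+)"] sum.cong) auto

text \<open>\<open>t 1, \<dots>, t m\<close> is the basis of the tangent space dual to the edge vectors \<open>v\<^sub>i\<^sub>-\<^sub>1 - v\<^sub>i\<close>,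
  so that \<open>inner w (t i)\<close> is the \<open>i\<close>-th cube coordinate of a tangent vector \<open>w\<close>.\<close>

definition edge_dual :: "'a::euclidean_space list \<Rightarrow> nat \<Rightarrow> (nat \<Rightarrow> 'a) \<Rightarrow> bool" where
  "edge_dual vs m t \<longleftrightarrow>
    (\<forall>i\<in>{1..m}. \<forall>j\<in>{1..m}. inner (vs ! (j - 1) - vs ! j) (t i) = (if i = j then 1 else 0)) \<and>
    (\<forall>i. t i \<in> tangent_space (set vs)) \<and>
    (\<forall>w. \<forall>u\<in>tangent_space (set vs). inner (w - (\<Sum>i=1..m. inner w (t i) *\<^sub>R (vs ! (i - 1) - vs ! i))) u = 0)"

lemma edge_dual_exists:
  fixes vs :: "'a::euclidean_space list"
  assumes "\<not> affine_dependent (set vs)" "distinct vs" and len: "length vs = m + 1"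
  shows "\<exists>t. edge_dual vs m t"
proof -
  let ?T = "tangent_space (set vs)" and ?E = "\<lambda>i. vs ! (i - 1) - vs ! i"
  have spanT: "span ?T = ?T" by (simp add: tangent_space_def span_span)
  have "\<exists>f a. linear f \<and> (\<forall>w\<in>set vs. f w + a = (if w = v then 1 else (0::real)))" if "v \<in> set vs" for v
    using affine_coordinate[OF assms(1) that] by metis
  then obtain f a where f: "\<And>v. v \<in> set vs \<Longrightarrow> linear (f v)"
      "\<And>v w. v \<in> set vs \<Longrightarrow> w \<in> set vs \<Longrightarrow> f v w + a v = (if w = v then 1 else (0::real))" by metis
  \<comment> \<open>The linear part of the \<open>i\<close>-th cube coordinate, which is the sum of
    the barycentric coordinates of the first \<open>i\<close> vertices.\<close>
  define g where "g i w = (\<Sum>j<i. f (vs ! j) w)" for i w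
  have lin: "linear (g i)" if "i \<le> m" for i
    unfolding g_def using that len f(1) by (intro linear_compose_sum) auto
  have g: "g i (vs ! p - vs ! q) = of_bool (p < i) - of_bool (q < i)" if "i \<le> m" "p \<le> m" "q \<le> m" for i p q
  proof -
    have "f (vs ! j) (vs ! p - vs ! q) = of_bool (p = j) - of_bool (q = j)" if "j < i" for j
    proof -
      have j: "j \<le> m" using that \<open>i \<le> m\<close> by simp
      then have "vs ! j \<in> set vs" "vs ! p \<in> set vs" "vs ! q \<in> set vs" using len \<open>p \<le> m\<close> \<open>q \<le> m\<close> by auto
      then have "f (vs ! j) (vs ! p - vs ! q) = of_bool (vs ! p = vs ! j) - of_bool (vs ! q = vs ! j)"
        using f(2)[of "vs ! j" "vs ! p"] f(2)[of "vs ! j" "vs ! q"] linear_diff[OF f(1)] by (auto split: if_splits)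
      then show ?thesis using assms(2) len j \<open>p \<le> m\<close> \<open>q \<le> m\<close> by (simp add: nth_eq_iff_index_eq)
    qed
    then have "g i (vs ! p - vs ! q) = (\<Sum>j<i. of_bool (p = j)) - (\<Sum>j<i. of_bool (q = j))"
      by (simp add: g_def sum_subtractf)
    then show ?thesis by (simp add: of_bool_def)
  qed
  have g_T: "(\<Sum>i=1..m. g i w *\<^sub>R ?E i) = w" if "w \<in> ?T" for w
  proof (rule linear_eq_on_span[where f = "\<lambda>w. \<Sum>i=1..m. g i w *\<^sub>R ?E i" and g = "\<lambda>w. w"])
    show "w \<in> span {u - v | u v. u \<in> set vs \<and> v \<in> set vs}" using that by (simp add: tangent_space_def)
    show "linear (\<lambda>w. \<Sum>i=1..m. g i w *\<^sub>R ?E i)"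
      using lin by (intro linear_compose_sum) (auto simp: linear_iff algebra_simps)
    show "linear (\<lambda>w::'a. w)" by (simp add: linear_iff)
    fix w assume "w \<in> {u - v | u v. u \<in> set vs \<and> v \<in> set vs}"
    then obtain p q where pq: "w = vs ! p - vs ! q" "p \<le> m" "q \<le> m"
      using len by (auto simp: in_set_conv_nth less_Suc_eq_le)
    have tel: "(\<Sum>i=1..m. of_bool (p < i) *\<^sub>R ?E i) = vs ! p - vs ! m" if "p \<le> m" for p
    proof -
      have "(\<Sum>i=1..m. of_bool (p < i) *\<^sub>R ?E i) = (\<Sum>i=Suc p..m. of_bool (p < i) *\<^sub>R ?E i)"
        by (rule sum.mono_neutral_right) auto
      also have "\<dots> = - (\<Sum>i=Suc p..m. vs ! i - vs ! (i - 1))"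
        by (simp add: sum_negf[symmetric])
      also have "\<dots> = vs ! p - vs ! m" using sum_telescope''[OF that, of "\<lambda>i. vs ! i"] by simp
      finally show ?thesis .
    qed
    have "(\<Sum>i=1..m. g i w *\<^sub>R ?E i) = (\<Sum>i=1..m. of_bool (p < i) *\<^sub>R ?E i - of_bool (q < i) *\<^sub>R ?E i)"
      using pq by (intro sum.cong) (auto simp: g scaleR_left_diff_distrib)
    also have "\<dots> = w" using pq tel by (simp add: sum_subtractf)
    finally show "(\<Sum>i=1..m. g i w *\<^sub>R ?E i) = w" .
  qed
  have "\<exists>t. t \<in> ?T \<and> (i \<in> {1..m} \<longrightarrow> (\<forall>w\<in>?T. inner w t = g i w))" for i
  proof (cases "i \<in> {1..m}")
    case False
    then show ?thesis using span_0[of ?T] spanT by auto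
  next
    case True
    define r where "r = (\<Sum>b\<in>Basis. g i b *\<^sub>R b)"
    have r: "g i w = inner w r" for w
    proof -
      have "g i w = g i (\<Sum>b\<in>Basis. inner w b *\<^sub>R b)" by (simp add: euclidean_representation)
      also have "\<dots> = (\<Sum>b\<in>Basis. inner w b * g i b)"
        using lin[of i] True by (simp add: linear_sum linear_scale)
      finally show ?thesis by (simp add: r_def inner_sum_right mult.commute)
    qed
    \<comment> \<open>The vector \<open>r\<close> representing \<open>g i\<close> on the whole space
      need not be tangent; its orthogonal projection represents the same functional on the tangent
      space.\<close>
    obtain y z where "y \<in> span ?T" "\<And>w. w \<in> span ?T \<Longrightarrow> orthogonal z w" "r = y + z"
      using orthogonal_subspace_decomp_exists[of ?T r] by metis
    then show ?thesis using r spanT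
      by (intro exI[of _ y]) (auto simp: inner_add_right orthogonal_def inner_commute)
  qed
  then obtain t where t: "\<And>i. t i \<in> ?T" "\<And>i w. i \<in> {1..m} \<Longrightarrow> w \<in> ?T \<Longrightarrow> inner w (t i) = g i w" by metis
  have E: "?E j \<in> ?T" if "j \<in> {1..m}" for j
    unfolding tangent_space_def using that len by (intro span_base) (force intro!: nth_mem)
  show ?thesis
    unfolding edge_dual_def
  proof (intro exI[of _ t] conjI ballI allI)
    fix i j assume ij: "i \<in> {1..m}" "j \<in> {1..m}"
    then show "inner (?E j) (t i) = (if i = j then 1 else 0)"
      using t(2)[OF ij(1) E[OF ij(2)]] g[of i "j - 1" j] by auto
  next
    fix w u assume u: "u \<in> ?T"
    obtain y z where yz: "y \<in> span ?T" "\<And>w. w \<in> span ?T \<Longrightarrow> orthogonal z w" "w = y + z"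
      using orthogonal_subspace_decomp_exists[of ?T w] by metis
    have "inner w (t i) = g i y" if "i \<in> {1..m}" for i
      using t(2)[OF that, of y] yz t(1) spanT by (auto simp: inner_add_left orthogonal_def)
    then have "(\<Sum>i=1..m. inner w (t i) *\<^sub>R ?E i) = y"
      using g_T[of y] yz(1) spanT by simp
    then show "inner (w - (\<Sum>i=1..m. inner w (t i) *\<^sub>R ?E i)) u = 0"
      using yz u spanT by (auto simp: orthogonal_def)
  qed (use t in auto)
qed

lemma iota_inv_inj:
  fixes vs :: "'a::euclidean_space list"
  assumes "\<not> affine_dependent (set vs)" "distinct vs" and len: "length vs = m + 1"
    and eq: "iota_inv vs x = iota_inv vs y" and i: "i \<in> {1..m}"
  shows "x i = y i"
proof -
  obtain t where "edge_dual vs m t" using edge_dual_exists[OF assms(1-3)] by blast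
  note t = this[unfolded edge_dual_def, THEN conjunct1, rule_format]
    this[unfolded edge_dual_def, THEN conjunct2, THEN conjunct1, rule_format]
    this[unfolded edge_dual_def, THEN conjunct2, THEN conjunct2, rule_format]
  have "inner (iota_inv vs z - vs ! m) (t i) = z i" for z
  proof -
    have "inner (iota_inv vs z - vs ! m) (t i) = (\<Sum>j=1..m. z j * inner (vs ! (j - 1) - vs ! j) (t i))"
      by (simp add: iota_inv_eq[OF len] inner_sum_left)
    also have "\<dots> = (\<Sum>j=1..m. if i = j then z j else 0)"
      using t(1) i by (intro sum.cong) auto
    finally show ?thesis using i by simp
  qed
  from this[of x] this[of y] show ?thesis using eq by simp
qed

section \<open>Shape, diameter and chord slopes of a single cell\<close>

definition crys_point :: "nat \<Rightarrow> nat \<Rightarrow> 'a::real_vector list \<Rightarrow> (nat \<Rightarrow> nat) \<Rightarrow> (nat \<Rightarrow> nat) \<Rightarrow> nat \<Rightarrow> 'a" where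
  "crys_point m l vs c \<pi> k = iota_inv vs (crys_vertex m l c \<pi> k)"

text \<open>The source of scale invariance: consecutive vertices of a cell differ by an edge of the
  large simplex, selected by \<open>\<pi>\<close> and scaled by \<open>1 / 2 ^ l\<close>, whatever
  the corner \<open>c\<close>.\<close>

lemma crys_point_diff:
  assumes "length vs = m + 1" "bij_betw \<pi> {1..m} {1..m}" "k \<in> {1..m}"
  shows "crys_point m l vs c \<pi> k - crys_point m l vs c \<pi> (k + 1) = (1 / 2 ^ l) *\<^sub>R (vs ! (\<pi> k - 1) - vs ! (\<pi> k))"
proof -
  have inj: "inj_on \<pi> {1..m}" and pk: "\<pi> k \<in> {1..m}" using assms by (auto simp: bij_betw_def)
  have k: "{k..m} = insert k {k+1..m}" using assms(3) by auto
  have "\<pi> k \<notin> \<pi> ` {k+1..m}" using inj_on_image_mem_iff[OF inj, of k "{k+1..m}"] assms(3) by simp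
  then have *: "crys_vertex m l c \<pi> k i - crys_vertex m l c \<pi> (k + 1) i = (if i = \<pi> k then 1 / 2 ^ l else 0)" for i
    unfolding crys_vertex_def k by (auto simp: diff_divide_distrib[symmetric])
  have "crys_point m l vs c \<pi> k - crys_point m l vs c \<pi> (k + 1) =
      (\<Sum>i=1..m. (crys_vertex m l c \<pi> k i - crys_vertex m l c \<pi> (k + 1) i) *\<^sub>R (vs ! (i - 1) - vs ! i))"
    unfolding crys_point_def iota_inv_eq[OF assms(1)]
    by (simp add: sum_subtractf[symmetric] scaleR_left_diff_distrib[symmetric])
  also have "\<dots> = (\<Sum>i=1..m. if i = \<pi> k then (1 / 2 ^ l) *\<^sub>R (vs ! (i - 1) - vs ! i) else 0)"
    unfolding * by (intro sum.cong) auto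
  finally show ?thesis using pk by simp
qed

lemma crys_point_inj:
  fixes vs :: "'a::euclidean_space list"
  assumes "\<not> affine_dependent (set vs)" "distinct vs" "length vs = m + 1" "bij_betw \<pi> {1..m} {1..m}"
  shows "inj_on (crys_point m l vs c \<pi>) {1..m+1}"
proof (rule linorder_inj_onI)
  fix k k' assume k: "k < k'" "k \<in> {1..m+1}" "k' \<in> {1..m+1}"
  have inj: "inj_on \<pi> {1..m}" and pk: "\<pi> k \<in> {1..m}" using assms(4) k by (auto simp: bij_betw_def)
  have "\<pi> k \<notin> \<pi> ` {k'..m}" "\<pi> k \<in> \<pi> ` {k..m}"
    using inj_on_image_mem_iff[OF inj, of k "{k'..m}"] k by auto
  then have "crys_vertex m l c \<pi> k (\<pi> k) \<noteq> crys_vertex m l c \<pi> k' (\<pi> k)" by (simp add: crys_vertex_def)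
  then show "crys_point m l vs c \<pi> k \<noteq> crys_point m l vs c \<pi> k'"
    unfolding crys_point_def using iota_inv_inj[OF assms(1-3) _ pk] by blast
qed auto

lemma crys_cell_bounds:
  fixes vs :: "'a::euclidean_space list"
  assumes aff: "\<not> affine_dependent (set vs)" "distinct vs" "length vs = m + 1"
  obtains C where "C > 0"
    "\<And>l c \<pi> k j. bij_betw \<pi> {1..m} {1..m} \<Longrightarrow> k \<in> {1..m+1} \<Longrightarrow> j \<in> {1..m+1} \<Longrightarrow>
       norm (crys_point m l vs c \<pi> k - crys_point m l vs c \<pi> j) \<le> C / 2 ^ l"
    "\<And>l c \<pi> (y :: 'a \<Rightarrow> 'b::euclidean_space) L e. bij_betw \<pi> {1..m} {1..m} \<Longrightarrow>
       chord_slope (set vs) (crys_point m l vs c \<pi> ` {1..m+1}) y L \<Longrightarrow>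
       (\<And>u w. u \<in> crys_point m l vs c \<pi> ` {1..m+1} \<Longrightarrow> w \<in> crys_point m l vs c \<pi> ` {1..m+1} \<Longrightarrow> norm (y u - y w) \<le> e) \<Longrightarrow>
       norm L \<le> C * 2 ^ l * e"
proof -
  let ?E = "\<lambda>i. vs ! (i - 1) - vs ! i"
  obtain t where "edge_dual vs m t" using edge_dual_exists[OF aff] by blast
  note t = this[unfolded edge_dual_def, THEN conjunct1, rule_format]
    this[unfolded edge_dual_def, THEN conjunct2, THEN conjunct1, rule_format]
    this[unfolded edge_dual_def, THEN conjunct2, THEN conjunct2, rule_format]
  \<comment> \<open>The edge vectors control the diameter, the dual basis controls the slope, and
    the summand 1 keeps the constant positive when \<open>m = 0\<close>.\<close>
  define C where "C = 1 + (\<Sum>i=1..m. norm (t i)) + (\<Sum>i=1..m. norm (?E i))"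
  have C: "1 \<le> C" "(\<Sum>i=1..m. norm (t i)) \<le> C" "(\<Sum>i=1..m. norm (?E i)) \<le> C"
    using sum_nonneg[of "{1..m}" "\<lambda>i. norm (t i)"] sum_nonneg[of "{1..m}" "\<lambda>i. norm (?E i)"]
    by (auto simp: C_def)
  show ?thesis
  proof (rule that[of C])
    show "C > 0" using C by simp
    fix l c k j and \<pi> :: "nat \<Rightarrow> nat" assume "bij_betw \<pi> {1..m} {1..m}"
    have *: "\<bar>crys_vertex m l c \<pi> k i - crys_vertex m l c \<pi> j i\<bar> \<le> 1 / 2 ^ l" for i
      by (auto simp: crys_vertex_def diff_divide_distrib[symmetric])
    have "crys_point m l vs c \<pi> k - crys_point m l vs c \<pi> j =
      (\<Sum>i=1..m. (crys_vertex m l c \<pi> k i - crys_vertex m l c \<pi> j i) *\<^sub>R ?E i)"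
      unfolding crys_point_def iota_inv_eq[OF aff(3)]
      by (simp add: sum_subtractf[symmetric] scaleR_left_diff_distrib[symmetric])
    then have "norm (crys_point m l vs c \<pi> k - crys_point m l vs c \<pi> j) \<le>
      (\<Sum>i=1..m. 1 / 2 ^ l * norm (?E i))"
      using mult_right_mono[OF *] by (auto intro!: sum_norm_le simp del: One_nat_def times_divide_eq_left)
    also have "\<dots> = (\<Sum>i=1..m. norm (?E i)) / 2 ^ l" by (simp add: sum_divide_distrib)
    also have "\<dots> \<le> C / 2 ^ l" using C by (intro divide_right_mono) auto
    finally show "norm (crys_point m l vs c \<pi> k - crys_point m l vs c \<pi> j) \<le> C / 2 ^ l" .
  next
    fix l c and \<pi> :: "nat \<Rightarrow> nat" and y :: "'a \<Rightarrow> 'b" and L :: "'a \<Rightarrow>\<^sub>L 'b" and e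
    let ?u = "crys_point m l vs c \<pi>"
    assume bij: "bij_betw \<pi> {1..m} {1..m}" and L: "chord_slope (set vs) (?u ` {1..m+1}) y L"
      and e: "\<And>u w. u \<in> ?u ` {1..m+1} \<Longrightarrow> w \<in> ?u ` {1..m+1} \<Longrightarrow> norm (y u - y w) \<le> e"
    have "norm (y (?u 1) - y (?u 1)) \<le> e" by (rule e) auto
    then have "e \<ge> 0" by simp
    have LE: "norm (L (?E i)) \<le> 2 ^ l * e" if "i \<in> {1..m}" for i
    proof -
      have "i \<in> \<pi> ` {1..m}" using that bij_betw_imp_surj_on[OF bij] by simp
      then obtain k where k: "k \<in> {1..m}" "i = \<pi> k" by blast
      have "(1 / 2 ^ l) *\<^sub>R L (?E i) = L (?u k - ?u (k + 1))"
        using crys_point_diff[OF aff(3) bij k(1)] k(2) by (simp add: blinfun.scaleR_right)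
      also have "\<dots> = y (?u k) - y (?u (k+1))" using L k(1) by (auto simp: chord_slope_def)
      finally have "norm ((1 / 2 ^ l) *\<^sub>R L (?E i)) \<le> e" using e k(1) by simp
      then show ?thesis by (simp add: field_simps)
    qed
    show "norm L \<le> C * 2 ^ l * e"
    proof (rule norm_blinfun_bound)
      show "0 \<le> C * 2 ^ l * e" using C \<open>e \<ge> 0\<close> by simp
      fix w
      \<comment> \<open>The subtracted sum is the tangential part of \<open>w\<close>; the rest is
        orthogonal to the tangent space, where elements of \<open>slopes\<close> vanish. Hence
        \<open>L\<close> is determined by its values on the edges.\<close>
      have "L (w - (\<Sum>i=1..m. inner w (t i) *\<^sub>R ?E i)) = 0"
        using L t(3)[of _ w] by (auto simp: chord_slope_def slopes_def)
      then have "L w = (\<Sum>i=1..m. inner w (t i) *\<^sub>R L (?E i))"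
        by (simp add: blinfun.diff_right blinfun.sum_right blinfun.scaleR_right)
      then have "norm (L w) \<le> (\<Sum>i=1..m. (norm w * norm (t i)) * (2 ^ l * e))"
        using LE Cauchy_Schwarz_ineq2[of w] by (auto intro!: sum_norm_le mult_mono)
      also have "\<dots> = (\<Sum>i=1..m. norm (t i)) * (2 ^ l * e * norm w)"
        by (simp add: sum_distrib_left sum_distrib_right mult_ac)
      also have "\<dots> \<le> C * (2 ^ l * e * norm w)" using C \<open>e \<ge> 0\<close> by (intro mult_right_mono) auto
      finally show "norm (L w) \<le> C * 2 ^ l * e * norm w" by (simp add: mult_ac)
    qed
  qed
qed

lemma chord_slope_exists:
  fixes vs :: "'a::euclidean_space list" and y :: "'a \<Rightarrow> 'b::euclidean_space"
  assumes aff: "\<not> affine_dependent (set vs)" "distinct vs" "length vs = m + 1"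
    and bij: "bij_betw \<pi> {1..m} {1..m}"
  obtains L where "chord_slope (set vs) (crys_point m l vs c \<pi> ` {1..m+1}) y L"
proof -
  let ?E = "\<lambda>i. vs ! (i - 1) - vs ! i" and ?u = "crys_point m l vs c \<pi>"
  obtain t where "edge_dual vs m t" using edge_dual_exists[OF aff] by blast
  note t = this[unfolded edge_dual_def, THEN conjunct1, rule_format]
    this[unfolded edge_dual_def, THEN conjunct2, THEN conjunct1, rule_format]
    this[unfolded edge_dual_def, THEN conjunct2, THEN conjunct2, rule_format]
  define \<tau> where "\<tau> = inv_into {1..m} \<pi>"
  have \<tau>: "\<tau> (\<pi> k) = k" if "k \<in> {1..m}" for k
    using bij that unfolding \<tau>_def by (intro inv_into_f_f) (auto simp: bij_betw_def)
  \<comment> \<open>The value required on the \<open>i\<close>-th edge: \<open>\<tau> i\<close> is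
    the step of the vertex path at which coordinate \<open>i\<close> drops, and \<open>2 ^ l\<close>
    undoes the scaling of that edge.\<close>
  define b where "b i = 2 ^ l *\<^sub>R (y (?u (\<tau> i)) - y (?u (\<tau> i + 1)))" for i
  define L where "L = (\<Sum>i=1..m. blinfun_scaleR_left (b i) o\<^sub>L blinfun_inner_left (t i))"
  have L: "L w = (\<Sum>i=1..m. inner w (t i) *\<^sub>R b i)" for w
    by (simp add: L_def blinfun.sum_left inner_commute)
  have "L \<in> slopes (set vs)" using t(2) by (auto simp: slopes_def L)
  moreover have LE: "L (?E j) = b j" if "j \<in> {1..m}" for j
  proof -
    have "L (?E j) = (\<Sum>i=1..m. if i = j then b i else 0)" unfolding L using t(1) that by (intro sum.cong) auto
    then show ?thesis using that by simp
  qed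
  \<comment> \<open>Constancy of \<open>L - y\<close> along the path passes from consecutive
    vertices to all pairs.\<close>
  moreover have step: "L (?u k) - y (?u k) = L (?u 1) - y (?u 1)" if "k \<in> {1..m+1}" for k
    using that
  proof (induction k)
    case (Suc k)
    show ?case
    proof (cases "k = 0")
      case False
      then have k: "k \<in> {1..m}" using Suc.prems by auto
      then have pk: "\<pi> k \<in> {1..m}" using bij by (auto simp: bij_betw_def)
      have "L (?u k) - L (?u (k + 1)) = (1 / 2 ^ l) *\<^sub>R b (\<pi> k)"
        using crys_point_diff[OF aff(3) bij k, of l c] LE[OF pk]
        by (simp add: blinfun.diff_right[symmetric] blinfun.scaleR_right)
      also have "\<dots> = y (?u k) - y (?u (k + 1))" using \<tau>[OF k] by (simp add: b_def)
      finally have "L (?u (Suc k)) - y (?u (Suc k)) = L (?u k) - y (?u k)" by (simp add: algebra_simps)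
      with Suc.IH k show ?thesis by simp
    qed simp
  qed simp
  have "L (u - w) = y u - y w" if uw: "u \<in> ?u ` {1..m+1}" "w \<in> ?u ` {1..m+1}" for u w
  proof -
    obtain j k where jk: "u = ?u j" "w = ?u k" "j \<in> {1..m+1}" "k \<in> {1..m+1}" using uw by blast
    have "L u - y u = L w - y w" using step[OF jk(3)] step[OF jk(4)] jk(1,2) by simp
    then show ?thesis by (simp add: blinfun.diff_right algebra_simps)
  qed
  ultimately show ?thesis using that[of L] by (auto simp: chord_slope_def)
qed

section \<open>Interpolation on the crystalline subdivision\<close>

lemma is_bary_iota:
  assumes "set vs \<in> K" "distinct vs" and len: "length vs = m + 1"
    and mono: "\<And>j. j \<le> m \<Longrightarrow> ext_coord m x j \<le> ext_coord m x (j + 1)"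
  obtains c where "is_bary K (iota_inv vs x) (set vs) c"
    "\<And>j. j \<le> m \<Longrightarrow> c (vs ! j) = ext_coord m x (j + 1) - ext_coord m x j"
proof -
  define idx where "idx = inv_into {..<m+1} ((!) vs)"
  have inj: "inj_on ((!) vs) {..<m+1}" using assms by (auto intro: inj_on_nth)
  have im: "(!) vs ` {..<m+1} = set vs" using len by (auto simp: set_conv_nth)
  have idx: "idx (vs ! j) = j" if "j < m + 1" for j
    unfolding idx_def using inj that by (intro inv_into_f_f) auto
  define c where "c v = (if v \<in> set vs then ext_coord m x (idx v + 1) - ext_coord m x (idx v) else 0)" for v
  have c: "c (vs ! j) = ext_coord m x (j + 1) - ext_coord m x j" if "j < m + 1" for j
    using that len idx[OF that] by (simp add: c_def)
  have "is_bary K (iota_inv vs x) (set vs) c" unfolding is_bary_def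
  proof (intro conjI ballI allI impI)
    show "set vs \<in> K" by fact
    show "0 \<le> c v" if "v \<in> set vs" for v
    proof -
      obtain j where "j < m + 1" "v = vs ! j" using \<open>v \<in> set vs\<close> im by auto
      then show ?thesis using c mono[of j] by simp
    qed
    show "c v = 0" if "v \<notin> set vs" for v using that by (simp add: c_def)
    have "sum c (set vs) = (\<Sum>j<m+1. c (vs ! j))"
      unfolding im[symmetric] by (rule sum.reindex[OF inj, unfolded o_def])
    also have "\<dots> = (\<Sum>j<m+1. ext_coord m x (Suc j) - ext_coord m x j)" using c by (intro sum.cong) auto
    also have "\<dots> = 1" unfolding sum_lessThan_telescope by (simp add: ext_coord_def)
    finally show "sum c (set vs) = 1" .
    have "(\<Sum>v\<in>set vs. c v *\<^sub>R v) = (\<Sum>j<m+1. c (vs ! j) *\<^sub>R vs ! j)"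
      unfolding im[symmetric] by (rule sum.reindex[OF inj, unfolded o_def])
    also have "\<dots> = iota_inv vs x" unfolding iota_inv_def using c len by (intro sum.cong) auto
    finally show "(\<Sum>v\<in>set vs. c v *\<^sub>R v) = iota_inv vs x" .
  qed
  then show ?thesis using that c by simp
qed

text \<open>The cube coordinates of all simplices at once: on a simplex containing \<open>p\<close>, \<open>cum K ord v p\<close> is the
  coordinate of \<open>\<iota> p\<close> attached to the number of vertices up to \<open>v\<close>.\<close>

definition cum :: "'a::euclidean_space set set \<Rightarrow> ('a \<times> 'a) set \<Rightarrow> 'a \<Rightarrow> 'a \<Rightarrow> real" where
  "cum K ord v p = (\<Sum>w | w \<in> \<Union>K \<and> (w, v) \<in> ord. bary K p w)"

text \<open>The partial sums are triangular with respect to the vertex order, so induction on the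
  number of predecessors recovers the barycentric coordinates, and these determine the
  point.\<close>

lemma cum_inj:
  assumes K: "finite K" "simplicial_complex K" and ord: "linear_order_on (\<Union>K) ord"
    and p: "p \<in> polyhedron K" and q: "q \<in> polyhedron K"
    and eq: "\<And>v. v \<in> \<Union>K \<Longrightarrow> cum K ord v p = cum K ord v q"
  shows "p = q"
proof -
  have fin: "finite (\<Union>K)" using K by (auto simp: simplicial_complex_def)
  let ?B = "\<lambda>v. {w. w \<in> \<Union>K \<and> (w, v) \<in> ord}"
  have finB: "finite (?B v)" for v using fin by (rule rev_finite_subset) blast
  have eqv: "bary K p v = bary K q v" if "v \<in> \<Union>K" for v
    using that
  proof (induction "card (?B v)" arbitrary: v rule: less_induct)
    case less
    have vB: "v \<in> ?B v" using ord less.prems by (auto simp: order_on_defs refl_on_def)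
    have "bary K p w = bary K q w" if w: "w \<in> ?B v - {v}" for w
    proof (rule less.hyps)
      have "trans ord" "antisym ord" using ord by (auto simp: order_on_defs)
      then have "?B w \<subseteq> ?B v" "v \<notin> ?B w" using w by (auto dest: transD antisymD)
      with vB have "?B w \<subset> ?B v" by blast
      then show "card (?B w) < card (?B v)" using finB by (rule psubset_card_mono[rotated])
      show "w \<in> \<Union>K" using w by simp
    qed
    then have "(\<Sum>w\<in>?B v - {v}. bary K p w) = (\<Sum>w\<in>?B v - {v}. bary K q w)" by (rule sum.cong[OF refl])
    then show ?case
      using eq[OF less.prems] sum.remove[OF finB vB, of "bary K p"] sum.remove[OF finB vB, of "bary K q"]
      by (simp add: cum_def)
  qed
  have *: "(\<Sum>v\<in>\<Union>K. bary K x v *\<^sub>R v) = x" if "x \<in> polyhedron K" for x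
  proof -
    obtain S where S: "S \<in> K" "x \<in> convex hull S" using \<open>x \<in> polyhedron K\<close> by (auto simp: polyhedron_def)
    have b: "is_bary K x S (bary K x)" by (rule is_bary_bary[OF K(2) S])
    have "(\<Sum>v\<in>\<Union>K. bary K x v *\<^sub>R v) = (\<Sum>v\<in>S. bary K x v *\<^sub>R v)"
      using fin b S(1) by (intro sum.mono_neutral_right) (auto simp: is_bary_def)
    then show ?thesis using b by (simp add: is_bary_def)
  qed
  have "p = (\<Sum>v\<in>\<Union>K. bary K p v *\<^sub>R v)" using *[OF p] by simp
  also have "\<dots> = (\<Sum>v\<in>\<Union>K. bary K q v *\<^sub>R v)" using eqv by (intro sum.cong) auto
  finally show ?thesis using *[OF q] by simp
qed

text \<open>The barycentric coordinates telescope. The index \<open>J v\<close> depends only on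
  \<open>S\<close> and \<open>v\<close>, also for \<open>v\<close> outside \<open>S\<close>, so on
  this simplex every \<open>cum\<close> function is a cube coordinate or one of the padding
  constants 0 and 1.\<close>

lemma cum_iota:
  assumes K: "finite K" "simplicial_complex K" and ord: "linear_order_on (\<Union>K) ord"
    and S: "S \<in> K" "set vs = S" "distinct vs" "sorted_wrt (\<lambda>a b. (a, b) \<in> ord) vs" and len: "length vs = m + 1"
  obtains J where "\<And>v. J v \<le> m + 1" "\<And>j. j \<le> m \<Longrightarrow> J (vs ! j) = j + 1"
    "\<And>v x. (\<And>j. j \<le> m \<Longrightarrow> ext_coord m x j \<le> ext_coord m x (j + 1)) \<Longrightarrow>
       cum K ord v (iota_inv vs x) = ext_coord m x (J v)"
proof -
  have fin: "finite (\<Union>K)" using K by (auto simp: simplicial_complex_def)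
  have ordp: "trans ord" "antisym ord" "\<And>v. v \<in> \<Union>K \<Longrightarrow> (v, v) \<in> ord"
    using ord by (auto simp: order_on_defs refl_on_def)
  \<comment> \<open>The length of the initial segment of \<open>vs\<close> that lies below or at
    \<open>v\<close>. The alternative \<open>j \<ge> m + 1\<close> covers a \<open>v\<close> above
    all vertices, where the padding value 1 applies.\<close>
  define J where "J v = (LEAST j. j \<ge> m + 1 \<or> (vs ! j, v) \<notin> ord)" for v
  have inS: "vs ! j \<in> S" if "j \<le> m" for j using that S len by auto
  have inK: "vs ! j \<in> \<Union>K" if "j \<le> m" for j using inS[OF that] S by blast
  have srt: "(vs ! i, vs ! j) \<in> ord" if "i \<le> j" "j \<le> m" for i j
    using that S(4) len ordp(3)[OF inK[of j]] by (cases "i = j") (auto simp: sorted_wrt_iff_nth_less)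
  have J1: "J v \<le> m + 1" for v unfolding J_def by (rule Least_le) simp
  have J_iff: "j < J v \<longleftrightarrow> j \<le> m \<and> (vs ! j, v) \<in> ord" for j v
  proof
    assume "j < J v"
    then have "\<not> (j \<ge> m + 1 \<or> (vs ! j, v) \<notin> ord)" unfolding J_def by (rule not_less_Least)
    then show "j \<le> m \<and> (vs ! j, v) \<in> ord" by auto
  next
    assume j: "j \<le> m \<and> (vs ! j, v) \<in> ord"
    have "J v \<ge> m + 1 \<or> (vs ! (J v), v) \<notin> ord" unfolding J_def by (rule LeastI[of _ "m+1"]) simp
    then show "j < J v"
      using j srt[of "J v" j] ordp(1) by (cases "J v \<le> j") (auto dest: transD)
  qed
  show ?thesis
  proof (rule that[of J])
    show "J v \<le> m + 1" for v by (rule J1)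
    fix j assume j: "j \<le> m"
    have "i < J (vs ! j) \<longleftrightarrow> i < j + 1" for i
    proof -
      have "(vs ! i, vs ! j) \<in> ord \<longleftrightarrow> i \<le> j" if "i \<le> m"
      proof
        assume *: "(vs ! i, vs ! j) \<in> ord"
        show "i \<le> j"
        proof (rule ccontr)
          assume "\<not> i \<le> j"
          then have "(vs ! j, vs ! i) \<in> ord" using srt that by auto
          with * ordp(2) have "vs ! i = vs ! j" by (auto dest: antisymD)
          then show False using S(3) len that j \<open>\<not> i \<le> j\<close> by (simp add: nth_eq_iff_index_eq)
        qed
      qed (use srt j in auto)
      then show ?thesis using j by (auto simp: J_iff)
    qed
    from this[of j] this[of "j + 1"] show "J (vs ! j) = j + 1" by linarith
  next
    fix v x assume mono: "\<And>j. j \<le> m \<Longrightarrow> ext_coord m x j \<le> ext_coord m x (j + 1)"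
    obtain c where c: "is_bary K (iota_inv vs x) (set vs) c"
      "\<And>j. j \<le> m \<Longrightarrow> c (vs ! j) = ext_coord m x (j + 1) - ext_coord m x j"
      using is_bary_iota[of vs K m x] S len mono by metis
    have bary: "bary K (iota_inv vs x) = c" by (rule bary_eq[OF K(2) c(1)])
    have inj: "inj_on ((!) vs) {..<J v}" using S(3) len J1[of v] by (auto intro: inj_on_nth)
    have im: "(!) vs ` {..<J v} = {w \<in> S. (w, v) \<in> ord}"
      using J_iff[of _ v] S(2) len inS by (auto simp: in_set_conv_nth less_Suc_eq_le image_iff) blast
    have "cum K ord v (iota_inv vs x) = (\<Sum>w\<in>{w \<in> S. (w, v) \<in> ord}. c w)"
      unfolding cum_def bary
    proof (rule sum.mono_neutral_right)
      show "finite {w \<in> \<Union>K. (w, v) \<in> ord}" using fin by (rule rev_finite_subset) blast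
    qed (use c(1) S(1,2) in \<open>auto simp: is_bary_def\<close>)
    also have "\<dots> = (\<Sum>j<J v. c (vs ! j))"
      unfolding im[symmetric] by (rule sum.reindex[OF inj, unfolded o_def])
    also have "\<dots> = (\<Sum>j<J v. ext_coord m x (Suc j) - ext_coord m x j)"
      using c(2) J1[of v] by (intro sum.cong) auto
    also have "\<dots> = ext_coord m x (J v)" unfolding sum_lessThan_telescope by (simp add: ext_coord_def)
    finally show "cum K ord v (iota_inv vs x) = ext_coord m x (J v)" .
  qed
qed

section \<open>Vertices of the subdivision as grid points\<close>

definition admissible :: "nat \<Rightarrow> nat \<Rightarrow> (nat \<Rightarrow> nat) \<Rightarrow> (nat \<Rightarrow> nat) \<Rightarrow> bool" where
  "admissible m l c \<pi> \<longleftrightarrow> (\<forall>i\<in>{1..m}. c i < 2 ^ l) \<and> bij_betw \<pi> {1..m} {1..m} \<and>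
     (\<forall>k\<in>{1..m+1}. \<forall>i\<in>{1..<m}. crys_vertex m l c \<pi> k i \<le> crys_vertex m l c \<pi> k (Suc i))"

lemma crys_simplices_eq:
  assumes "length (ordered_vertices ord S) = m + 1"
  shows "crys_simplices ord l S =
    {convex hull (crys_point m l (ordered_vertices ord S) c \<pi> ` {1..m+1}) | c \<pi>. admissible m l c \<pi>}"
  using assms by (simp add: crys_simplices_def Let_def admissible_def crys_point_def image_image)

text \<open>All grid points of the simplices, without reference to cells. The interpolation sum
  needs only a finite set that contains the vertices of every cell and has integral scaled
  coordinates.\<close>

definition crys_points :: "'a::euclidean_space set set \<Rightarrow> ('a \<times> 'a) set \<Rightarrow> nat \<Rightarrow> 'a set" where
  "crys_points K ord l = (\<Union>S\<in>K. (\<lambda>a. iota_inv (ordered_vertices ord S) (\<lambda>i. real (a i) / 2 ^ l)) `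
     {a \<in> {1..card S - 1} \<rightarrow>\<^sub>E {0..2 ^ l}. \<forall>i\<in>{1..<card S - 1}. a i \<le> a (Suc i)})"

lemma finite_crys_points:
  assumes "finite K"
  shows "finite (crys_points K ord l)"
  unfolding crys_points_def using assms by (intro finite_UN_I finite_imageI) (auto intro!: finite_PiE)

lemma ext_coord_mono:
  assumes "\<And>i. i \<in> {1..m} \<Longrightarrow> 0 \<le> x i \<and> x i \<le> 1" "\<And>i. i \<in> {1..<m} \<Longrightarrow> x i \<le> x (Suc i)" "j \<le> m"
  shows "ext_coord m x j \<le> ext_coord m x (j + 1)"
  using assms by (auto simp: ext_coord_def)

lemma crys_vertex_mono:
  assumes adm: "admissible m l c \<pi>" and "k \<in> {1..m+1}" "j \<le> m"
  shows "ext_coord m (crys_vertex m l c \<pi> k) j \<le> ext_coord m (crys_vertex m l c \<pi> k) (j + 1)"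
proof (rule ext_coord_mono)
  fix i assume "i \<in> {1..m}"
  then have ci: "c i < 2 ^ l" using adm by (auto simp: admissible_def)
  then have "real (c i + 1) \<le> real (2 ^ l)" by (intro of_nat_mono) simp
  moreover define e :: real where "e = (if i \<in> \<pi> ` {k..m} then 1 else 0)"
  then have "0 \<le> e" "e \<le> 1" by auto
  ultimately show "0 \<le> crys_vertex m l c \<pi> k i \<and> crys_vertex m l c \<pi> k i \<le> 1"
    unfolding crys_vertex_def e_def[symmetric] by (simp add: divide_le_eq)
qed (use assms in \<open>auto simp: admissible_def\<close>)

lemma crys_point_in_hull:
  fixes vs :: "'a::euclidean_space list"
  assumes "distinct vs" "length vs = m + 1" and adm: "admissible m l c \<pi>" and k: "k \<in> {1..m+1}"
  shows "crys_point m l vs c \<pi> k \<in> convex hull set vs"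
proof -
  obtain d where "is_bary {set vs} (crys_point m l vs c \<pi> k) (set vs) d"
    unfolding crys_point_def using is_bary_iota[of vs "{set vs}" m] assms(1,2) crys_vertex_mono[OF adm k] by blast
  then show ?thesis by (auto simp: is_bary_def convex_hull_finite)
qed

lemma crys_point_in_crys_points:
  assumes S: "S \<in> K" "length (ordered_vertices ord S) = m + 1" "card S = m + 1"
    and adm: "admissible m l c \<pi>" and k: "k \<in> {1..m+1}"
  shows "crys_point m l (ordered_vertices ord S) c \<pi> k \<in> crys_points K ord l"
proof -
  define a where "a = (\<lambda>i\<in>{1..m}. c i + (if i \<in> \<pi> ` {k..m} then 1 else 0))"
  have a: "crys_vertex m l c \<pi> k i = real (a i) / 2 ^ l" if "i \<in> {1..m}" for i
    using that by (simp add: a_def crys_vertex_def)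
  have "a i \<le> a (Suc i)" if "i \<in> {1..<m}" for i
  proof -
    have "crys_vertex m l c \<pi> k i \<le> crys_vertex m l c \<pi> k (Suc i)"
      using adm k that by (simp add: admissible_def)
    then show ?thesis using a[of i] a[of "Suc i"] that by (simp add: divide_le_cancel)
  qed
  moreover have "a i \<le> 2 ^ l" if "i \<in> {1..m}" for i
  proof -
    have "c i < 2 ^ l" using adm that by (simp add: admissible_def)
    then show ?thesis using that by (simp add: a_def)
  qed
  then have "a \<in> {1..m} \<rightarrow>\<^sub>E {0..2 ^ l}" by (auto simp: a_def)
  moreover have "crys_point m l (ordered_vertices ord S) c \<pi> k =
      iota_inv (ordered_vertices ord S) (\<lambda>i. real (a i) / 2 ^ l)"
    unfolding crys_point_def by (rule iota_inv_cong[OF S(2) a])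
  ultimately show ?thesis
    unfolding crys_points_def by (intro UN_I[OF S(1)] image_eqI[of _ _ a]) (auto simp: S(3))
qed

text \<open>Integrality holds at every \<open>v\<close>, not just at vertices of a simplex
  containing \<open>u\<close>. This allows \<open>u\<close> to be compared with cells of any other
  simplex.\<close>

lemma crys_points_grid:
  assumes K: "finite K" "simplicial_complex K" and ord: "linear_order_on (\<Union>K) ord"
    and u: "u \<in> crys_points K ord l"
  shows "u \<in> polyhedron K" "2 ^ l * cum K ord v u \<in> \<int>"
proof -
  obtain S a where S: "S \<in> K" and a: "a \<in> {1..card S - 1} \<rightarrow>\<^sub>E {0..2 ^ l}" "\<forall>i\<in>{1..<card S - 1}. a i \<le> a (Suc i)"
    and ua: "u = iota_inv (ordered_vertices ord S) (\<lambda>i. real (a i) / 2 ^ l)"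
    using u unfolding crys_points_def by blast
  define vs m where "vs = ordered_vertices ord S" and "m = card S - 1"
  have SK: "S \<noteq> {}" "finite S" "S \<subseteq> \<Union>K" using K S by (auto simp: simplicial_complex_def)
  note vs = ordered_vertices[OF ord SK(2,3), folded vs_def]
  have "vs \<noteq> []" using vs(1) SK(1) by auto
  then have len: "length vs = m + 1" using distinct_card[OF vs(2)] vs(1) by (cases vs) (auto simp: m_def)
  let ?x = "\<lambda>i. real (a i) / 2 ^ l"
  have mono: "ext_coord m ?x j \<le> ext_coord m ?x (j + 1)" if "j \<le> m" for j
  proof (rule ext_coord_mono)
    fix i assume "i \<in> {1..m}"
    then have "a i \<in> {0..2 ^ l}" unfolding m_def using a(1) by (blast dest: PiE_mem)
    then have "real (a i) \<le> real (2 ^ l)" by (simp only: of_nat_le_iff atLeastAtMost_iff)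
    then show "0 \<le> ?x i \<and> ?x i \<le> 1" by simp
  qed (use a(2) that in \<open>auto simp: m_def divide_right_mono\<close>)
  obtain d where d: "is_bary K (iota_inv vs ?x) (set vs) d"
    by (rule is_bary_iota[of vs K m ?x]) (use vs S len mono in auto)
  then have "u \<in> convex hull S"
    using vs(1) ua SK(2) by (auto simp: is_bary_def convex_hull_finite vs_def)
  then show "u \<in> polyhedron K" using S by (auto simp: polyhedron_def)
  obtain J where J: "\<And>v. J v \<le> m + 1" "\<And>j. j \<le> m \<Longrightarrow> J (vs ! j) = j + 1"
    "\<And>v x. (\<And>j. j \<le> m \<Longrightarrow> ext_coord m x j \<le> ext_coord m x (j + 1)) \<Longrightarrow>
       cum K ord v (iota_inv vs x) = ext_coord m x (J v)"
    by (rule cum_iota[OF K ord S vs len]) blast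
  have "cum K ord v u = ext_coord m ?x (J v)" unfolding ua vs_def[symmetric] by (rule J(3)[OF mono])
  then show "2 ^ l * cum K ord v u \<in> \<int>" by (simp add: ext_coord_def)
qed

text \<open>A finite element expansion in nodal functions. No simplex is singled out, so agreement
  along common faces is built in and never has to be checked.\<close>

definition crys_interp :: "'a::euclidean_space set set \<Rightarrow> ('a \<times> 'a) set \<Rightarrow> nat \<Rightarrow> ('a \<Rightarrow> 'b::real_vector) \<Rightarrow> 'a \<Rightarrow> 'b" where
  "crys_interp K ord l y p =
     (\<Sum>u\<in>crys_points K ord l. hat (\<Union>K) (\<lambda>v. 2 ^ l * (cum K ord v p - cum K ord v u)) *\<^sub>R y u)"

lemma continuous_on_crys_interp:
  fixes y :: "'a::euclidean_space \<Rightarrow> 'b::real_normed_vector"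
  assumes K: "finite K" "simplicial_complex K"
  shows "continuous_on (polyhedron K) (crys_interp K ord l y)"
proof -
  have "finite (\<Union>K)" using K by (auto simp: simplicial_complex_def)
  moreover have "continuous_on (polyhedron K) (\<lambda>p. cum K ord v p)" for v
    unfolding cum_def by (intro continuous_on_sum continuous_on_bary K)
  ultimately show ?thesis unfolding crys_interp_def
    by (intro continuous_on_sum continuous_on_scaleR continuous_on_hat continuous_intros) auto
qed

text \<open>In the scaled coordinates the cell is a chain of lattice points above an integral
  corner. Among all grid points only its own vertices have nonzero nodal functions there, and these
  take the values \<open>\<mu> k\<close>.\<close>

lemma crys_interp_convex_comb:
  fixes y :: "'a::euclidean_space \<Rightarrow> 'b::euclidean_space"
  assumes K: "finite K" "simplicial_complex K" and ord: "linear_order_on (\<Union>K) ord"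
    and S: "S \<in> K" "card S = m + 1" and vs: "vs = ordered_vertices ord S"
    and adm: "admissible m l c \<pi>"
    and \<mu>: "\<And>k. k \<in> {1..m+1} \<Longrightarrow> 0 \<le> \<mu> k" "sum \<mu> {1..m+1} = 1"
  shows "crys_interp K ord l y (\<Sum>k\<in>{1..m+1}. \<mu> k *\<^sub>R crys_point m l vs c \<pi> k) =
    (\<Sum>k\<in>{1..m+1}. \<mu> k *\<^sub>R y (crys_point m l vs c \<pi> k))"
proof -
  let ?u = "crys_point m l vs c \<pi>" and ?I = "{1..m+1}" and ?V = "\<Union>K"
  define p where "p = (\<Sum>k\<in>?I. \<mu> k *\<^sub>R ?u k)"
  have finV: "finite ?V" using K by (auto simp: simplicial_complex_def)
  have SK: "S \<noteq> {}" "finite S" "S \<subseteq> \<Union>K" "\<not> affine_dependent S" using K S by (auto simp: simplicial_complex_def)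
  note vsp = ordered_vertices[OF ord SK(2,3), folded vs]
  have len: "length vs = m + 1" using distinct_card[OF vsp(2)] vsp(1) S by simp
  have aff: "\<not> affine_dependent (set vs)" using vsp SK by simp
  have bij: "bij_betw \<pi> {1..m} {1..m}" and inj: "inj_on \<pi> {1..m}"
    using adm by (auto simp: admissible_def bij_betw_def)
  obtain J where J: "\<And>v. J v \<le> m + 1" "\<And>j. j \<le> m \<Longrightarrow> J (vs ! j) = j + 1"
    "\<And>v x. (\<And>j. j \<le> m \<Longrightarrow> ext_coord m x j \<le> ext_coord m x (j + 1)) \<Longrightarrow>
       cum K ord v (iota_inv vs x) = ext_coord m x (J v)"
    by (rule cum_iota[OF K ord S(1) vsp len]) blast
  \<comment> \<open>The position of coordinate \<open>J v\<close> in the order \<open>\<pi>\<close>.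
    The padding coordinates 0 and \<open>m + 1\<close> are constant along the chain; position 0
    expresses this, since vertices are numbered from 1.\<close>
  define \<kappa> where "\<kappa> v = (if J v \<in> {1..m} then inv_into {1..m} \<pi> (J v) else 0)" for v
  \<comment> \<open>The scaled corner of the cube, extended by the padding: it is
    \<open>2 ^ l\<close> where \<open>J v = m + 1\<close>.\<close>
  define w where "w v = 2 ^ l * ext_coord m (\<lambda>i. real (c i) / 2 ^ l) (J v)" for v
  have wint: "w v \<in> \<int>" for v by (simp add: w_def ext_coord_def)
  have \<kappa>0: "\<kappa> v = 0" if "J v \<notin> {1..m}" for v
    unfolding \<kappa>_def using that by (rule if_not_P)
  have \<kappa>inv: "\<pi> (\<kappa> v) = J v" "\<kappa> v \<in> {1..m}" if "J v \<in> {1..m}" for v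
  proof -
    have "J v \<in> \<pi> ` {1..m}" using that bij_betw_imp_surj_on[OF bij] by simp
    from f_inv_into_f[OF this] inv_into_into[OF this] show "\<pi> (\<kappa> v) = J v" "\<kappa> v \<in> {1..m}"
      using that by (simp_all add: \<kappa>_def)
  qed
  have \<kappa>m: "\<kappa> v \<le> m" for v
  proof (cases "J v \<in> {1..m}")
    case True
    then show ?thesis using \<kappa>inv(2) by simp
  next
    case False
    then show ?thesis using \<kappa>0 by simp
  qed
  have \<kappa>sub: "{1..m} \<subseteq> \<kappa> ` ?V"
  proof
    fix k assume k: "k \<in> {1..m}"
    then have pk: "\<pi> k \<in> {1..m}" using bij by (auto simp: bij_betw_def)
    then have "J (vs ! (\<pi> k - 1)) = \<pi> k" using J(2)[of "\<pi> k - 1"] by auto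
    then have "\<kappa> (vs ! (\<pi> k - 1)) = k" using pk inv_into_f_f[OF inj k] by (simp add: \<kappa>_def)
    moreover have "vs ! (\<pi> k - 1) \<in> set vs" using pk len by (intro nth_mem) auto
    then have "vs ! (\<pi> k - 1) \<in> ?V" using vsp(1) SK(3) by blast
    ultimately show "k \<in> \<kappa> ` ?V" by force
  qed
  have cum_u: "2 ^ l * cum K ord v (?u k) = w v + (if k \<le> \<kappa> v then 1 else 0)" if k: "k \<in> ?I" for v k
  proof -
    have *: "cum K ord v (?u k) = ext_coord m (crys_vertex m l c \<pi> k) (J v)"
      unfolding crys_point_def by (rule J(3)[OF crys_vertex_mono[OF adm k]])
    show ?thesis
    proof (cases "J v \<in> {1..m}")
      case True
      have "J v \<in> \<pi> ` {k..m} \<longleftrightarrow> \<kappa> v \<in> {k..m}"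
        using inj_on_image_mem_iff[OF inj \<kappa>inv(2)[OF True], of "{k..m}"] \<kappa>inv(1)[OF True] k by simp
      then have "J v \<in> \<pi> ` {k..m} \<longleftrightarrow> k \<le> \<kappa> v" using \<kappa>m[of v] by simp
      moreover have "J v \<noteq> 0" "J v \<noteq> m + 1" using True by auto
      ultimately show ?thesis unfolding * by (simp add: ext_coord_def w_def crys_vertex_def)
    next
      case False
      then have "J v = 0 \<or> J v = m + 1" using J(1)[of v] by auto
      moreover have "\<kappa> v = 0" using False by (rule \<kappa>0)
      ultimately show ?thesis unfolding * using k by (auto simp: ext_coord_def w_def)
    qed
  qed
  have cum_p: "2 ^ l * cum K ord v p = w v + sum \<mu> {1..\<kappa> v}" for v
  proof -
    have uS: "?u k \<in> convex hull S" if "k \<in> ?I" for k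
      using crys_point_in_hull[OF vsp(2) len adm that] vsp(1) by simp
    have "cum K ord v p = (\<Sum>x | x \<in> ?V \<and> (x, v) \<in> ord. \<Sum>k\<in>?I. \<mu> k * bary K (?u k) x)"
      unfolding cum_def p_def using bary_convex_comb[OF K(2) S(1), of ?I ?u \<mu>] uS \<mu> by simp
    also have "\<dots> = (\<Sum>k\<in>?I. \<mu> k * cum K ord v (?u k))"
      unfolding cum_def sum_distrib_left by (rule sum.swap)
    finally have "2 ^ l * cum K ord v p = (\<Sum>k\<in>?I. \<mu> k * (2 ^ l * cum K ord v (?u k)))"
      by (simp only: sum_distrib_left mult.left_commute)
    also have "\<dots> = (\<Sum>k\<in>?I. \<mu> k * w v + (if k \<le> \<kappa> v then \<mu> k else 0))"
      by (intro sum.cong refl, subst cum_u) (auto simp: distrib_left)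
    also have "\<dots> = w v + (\<Sum>k\<in>?I. if k \<le> \<kappa> v then \<mu> k else 0)"
      using \<mu>(2) by (simp add: sum.distrib sum_distrib_right[symmetric])
    also have "(\<Sum>k\<in>?I. if k \<le> \<kappa> v then \<mu> k else 0) = (\<Sum>k\<in>{k \<in> ?I. k \<le> \<kappa> v}. \<mu> k)"
      by (rule sum.inter_filter[symmetric]) simp
    also have "{k \<in> ?I. k \<le> \<kappa> v} = {1..\<kappa> v}" using \<kappa>m[of v] by auto
    finally show ?thesis .
  qed
  define h where "h u = hat ?V (\<lambda>v. 2 ^ l * (cum K ord v p - cum K ord v u))" for u
  have h1: "h (?u k) = \<mu> k" if k: "k \<in> ?I" for k
  proof -
    have "2 ^ l * (cum K ord v p - cum K ord v (?u k)) = sum \<mu> {1..\<kappa> v} - (if k \<le> \<kappa> v then 1 else 0)" for v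
      using cum_p[of v] cum_u[OF k, of v] by (simp add: right_diff_distrib)
    then show ?thesis unfolding h_def
      using hat_chain_vertex[OF finV \<kappa>sub \<kappa>m \<mu> k] by simp
  qed
  have h0: "u \<in> ?u ` ?I" if u: "u \<in> crys_points K ord l" "h u \<noteq> 0" for u
  proof -
    \<comment> \<open>The offset of \<open>u\<close> from the corner is integral, so the support
      lemma places it in the chain. Injectivity of the \<open>cum\<close> coordinates then
      identifies \<open>u\<close> with a vertex of the cell, even if \<open>u\<close> was listed for
      another simplex.\<close>
    define z where "z v = 2 ^ l * cum K ord v u - w v" for v
    have "2 ^ l * (cum K ord v p - cum K ord v u) = sum \<mu> {1..\<kappa> v} - z v" for v
      using cum_p[of v] by (simp add: z_def right_diff_distrib)
    then have nz: "hat ?V (\<lambda>v. sum \<mu> {1..\<kappa> v} - z v) \<noteq> 0" using u(2) by (simp add: h_def)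
    have zi: "z v \<in> \<int>" for v unfolding z_def by (intro Ints_diff wint crys_points_grid(2)[OF K ord u(1)])
    obtain k where k: "k \<in> ?I" "\<And>v. v \<in> ?V \<Longrightarrow> z v = (if k \<le> \<kappa> v then 1 else 0)"
      by (rule hat_chain_support[OF finV \<kappa>m \<mu> zi nz]) blast+
    have uk: "?u k \<in> crys_points K ord l"
      using crys_point_in_crys_points[of S K ord m] S(1,2) len adm k(1) unfolding vs by blast
    have "u = ?u k"
    proof (rule cum_inj[OF K ord])
      fix v assume v: "v \<in> ?V"
      have "2 ^ l * cum K ord v u = 2 ^ l * cum K ord v (?u k)"
        using k(2)[OF v] cum_u[OF k(1), of v] unfolding z_def by linarith
      then show "cum K ord v u = cum K ord v (?u k)" by simp
    qed (use crys_points_grid(1)[OF K ord] u(1) uk in auto)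
    with k(1) show ?thesis by blast
  qed
  have sub: "?u ` ?I \<subseteq> crys_points K ord l"
    using crys_point_in_crys_points[of S K ord m] S(1,2) len adm unfolding vs by blast
  have "crys_interp K ord l y p = (\<Sum>u\<in>crys_points K ord l. h u *\<^sub>R y u)"
    by (simp add: crys_interp_def h_def)
  also have "\<dots> = (\<Sum>u\<in>?u ` ?I. h u *\<^sub>R y u)"
    using h0 sub finite_crys_points[OF K(1)] by (intro sum.mono_neutral_right) auto
  also have "\<dots> = (\<Sum>k\<in>?I. h (?u k) *\<^sub>R y (?u k))"
    by (rule sum.reindex[OF crys_point_inj[OF aff vsp(2) len bij], unfolded o_def])
  also have "\<dots> = (\<Sum>k\<in>?I. \<mu> k *\<^sub>R y (?u k))" using h1 by (intro sum.cong) auto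
  finally show ?thesis by (simp add: p_def)
qed

lemma crys_interp_affine:
  fixes y :: "'a::euclidean_space \<Rightarrow> 'b::euclidean_space"
  assumes K: "finite K" "simplicial_complex K" and ord: "linear_order_on (\<Union>K) ord"
    and S: "S \<in> K" "card S = m + 1" and adm: "admissible m l c \<pi>"
    and U: "U = crys_point m l (ordered_vertices ord S) c \<pi> ` {1..m+1}"
    and L: "chord_slope S U y L" and x: "x \<in> convex hull U" and u: "u \<in> U"
  shows "crys_interp K ord l y x = y u + L (x - u)"
proof -
  define vs where "vs = ordered_vertices ord S"
  let ?u = "crys_point m l vs c \<pi>" and ?I = "{1..m+1}"
  have SK: "finite S" "S \<subseteq> \<Union>K" "\<not> affine_dependent S" using K S by (auto simp: simplicial_complex_def)
  note vsp = ordered_vertices[OF ord SK(1,2), folded vs_def]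
  have len: "length vs = m + 1" using distinct_card[OF vsp(2)] vsp(1) S by simp
  have aff: "\<not> affine_dependent (set vs)" using vsp SK by simp
  have bij: "bij_betw \<pi> {1..m} {1..m}" using adm by (simp add: admissible_def)
  have inj: "inj_on ?u ?I" by (rule crys_point_inj[OF aff vsp(2) len bij])
  have U': "U = ?u ` ?I" by (simp add: U vs_def)
  obtain \<nu> where \<nu>: "\<forall>p\<in>U. 0 \<le> \<nu> p" "sum \<nu> U = 1" "(\<Sum>p\<in>U. \<nu> p *\<^sub>R p) = x"
    using x by (auto simp: U convex_hull_finite)
  have re: "sum f U = (\<Sum>k\<in>?I. f (?u k))" for f :: "'a \<Rightarrow> 'c::comm_monoid_add"
    unfolding U' by (rule sum.reindex[OF inj, unfolded o_def])
  have "crys_interp K ord l y x = (\<Sum>k\<in>?I. \<nu> (?u k) *\<^sub>R y (?u k))"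
    using crys_interp_convex_comb[OF K ord S vs_def adm, of "\<lambda>k. \<nu> (?u k)" y] \<nu>(1,2)
    unfolding \<nu>(3)[symmetric] re[of "\<lambda>p. \<nu> p *\<^sub>R p"] re[of \<nu>] by (simp add: U')
  also have "\<dots> = (\<Sum>p\<in>U. \<nu> p *\<^sub>R y p)" by (rule re[symmetric])
  also have "\<dots> = (\<Sum>p\<in>U. \<nu> p *\<^sub>R y u + \<nu> p *\<^sub>R L (p - u))"
    using L u by (intro sum.cong) (auto simp: chord_slope_def scaleR_add_right[symmetric])
  also have "\<dots> = y u + L (\<Sum>p\<in>U. \<nu> p *\<^sub>R (p - u))"
    using \<nu>(2) by (simp add: sum.distrib scaleR_left.sum[symmetric] blinfun.sum_right blinfun.scaleR_right)
  also have "(\<Sum>p\<in>U. \<nu> p *\<^sub>R (p - u)) = x - u"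
    using \<nu>(2,3) by (simp add: scaleR_diff_right sum_subtractf scaleR_left.sum[symmetric])
  finally show ?thesis .
qed

section \<open>Cells and colours\<close>

definition is_cell :: "('a::euclidean_space \<times> 'a) set \<Rightarrow> nat \<Rightarrow> nat \<Rightarrow> 'a set \<Rightarrow> 'a set \<Rightarrow> bool" where
  "is_cell ord m l S U \<longleftrightarrow>
     (\<exists>c \<pi>. admissible m l c \<pi> \<and> U = crys_point m l (ordered_vertices ord S) c \<pi> ` {1..m+1})"

lemma simplex_list:
  assumes K: "finite K" "simplicial_complex K" and ord: "linear_order_on (\<Union>K) ord"
    and S: "S \<in> K" "card S = m + 1"
  shows "set (ordered_vertices ord S) = S" "distinct (ordered_vertices ord S)"
    "length (ordered_vertices ord S) = m + 1" "\<not> affine_dependent (set (ordered_vertices ord S))"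
    "finite S"
proof -
  have SK: "finite S" "S \<subseteq> \<Union>K" "\<not> affine_dependent S" using K S by (auto simp: simplicial_complex_def)
  note vs = ordered_vertices[OF ord SK(1,2)]
  show "set (ordered_vertices ord S) = S" "distinct (ordered_vertices ord S)" "finite S"
    "\<not> affine_dependent (set (ordered_vertices ord S))"
    using vs SK by auto
  show "length (ordered_vertices ord S) = m + 1" using distinct_card[OF vs(2)] vs(1) S(2) by simp
qed

lemma is_cell_hull:
  assumes "finite K" "simplicial_complex K" "linear_order_on (\<Union>K) ord" "S \<in> K" "card S = m + 1"
    and "is_cell ord m l S U"
  shows "U \<subseteq> convex hull S" "U \<noteq> {}"
proof -
  note vs = simplex_list[OF assms(1-5)]
  obtain c \<pi> where c: "admissible m l c \<pi>" "U = crys_point m l (ordered_vertices ord S) c \<pi> ` {1..m+1}"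
    using assms(6) by (auto simp: is_cell_def)
  show "U \<noteq> {}" using c by simp
  have "crys_point m l (ordered_vertices ord S) c \<pi> k \<in> convex hull S" if "k \<in> {1..m+1}" for k
    using crys_point_in_hull[OF vs(2,3) c(1) that] vs(1) by simp
  then show "U \<subseteq> convex hull S" using c(2) by blast
qed

lemma is_cell_bounds:
  assumes "finite K" "simplicial_complex K" "linear_order_on (\<Union>K) ord" "S \<in> K" "card S = m + 1"
  shows "\<exists>C>0. \<forall>l U. is_cell ord m l S U \<longrightarrow> (\<forall>u\<in>U. \<forall>w\<in>U. norm (u - w) \<le> C / 2 ^ l) \<and>
    (\<forall>(y :: 'a::euclidean_space \<Rightarrow> 'b::euclidean_space) L e. chord_slope S U y L \<longrightarrow>
        (\<forall>u\<in>U. \<forall>w\<in>U. norm (y u - y w) \<le> e) \<longrightarrow> norm L \<le> C * 2 ^ l * e)"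
proof -
  note vs = simplex_list[OF assms]
  obtain C where C: "C > 0"
    "\<And>l c \<pi> k j. bij_betw \<pi> {1..m} {1..m} \<Longrightarrow> k \<in> {1..m+1} \<Longrightarrow> j \<in> {1..m+1} \<Longrightarrow>
       norm (crys_point m l (ordered_vertices ord S) c \<pi> k - crys_point m l (ordered_vertices ord S) c \<pi> j) \<le> C / 2 ^ l"
    "\<And>l c \<pi> (y :: 'a \<Rightarrow> 'b::euclidean_space) L e. bij_betw \<pi> {1..m} {1..m} \<Longrightarrow>
       chord_slope (set (ordered_vertices ord S)) (crys_point m l (ordered_vertices ord S) c \<pi> ` {1..m+1}) y L \<Longrightarrow>
       (\<And>u w. u \<in> crys_point m l (ordered_vertices ord S) c \<pi> ` {1..m+1} \<Longrightarrow>
          w \<in> crys_point m l (ordered_vertices ord S) c \<pi> ` {1..m+1} \<Longrightarrow> norm (y u - y w) \<le> e) \<Longrightarrow>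
       norm L \<le> C * 2 ^ l * e"
    using crys_cell_bounds[OF vs(4,2,3), where 'b = 'b] by blast
  show ?thesis
  proof (intro exI[of _ C] conjI allI impI ballI)
    show "C > 0" by fact
    fix l U u w assume "is_cell ord m l S U" and uw: "u \<in> U" "w \<in> U"
    then obtain c \<pi> where c: "admissible m l c \<pi>" "U = crys_point m l (ordered_vertices ord S) c \<pi> ` {1..m+1}"
      by (auto simp: is_cell_def)
    then show "norm (u - w) \<le> C / 2 ^ l" using uw C(2) unfolding admissible_def by blast
  next
    fix l U and y :: "'a \<Rightarrow> 'b" and L e
    assume "is_cell ord m l S U" and L: "chord_slope S U y L" "\<forall>u\<in>U. \<forall>w\<in>U. norm (y u - y w) \<le> e"
    then obtain c \<pi> where c: "admissible m l c \<pi>" "U = crys_point m l (ordered_vertices ord S) c \<pi> ` {1..m+1}"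
      by (auto simp: is_cell_def)
    show "norm L \<le> C * 2 ^ l * e"
      by (rule C(3)[of \<pi> l c y L e]) (use c L vs(1) in \<open>auto simp: admissible_def\<close>)
  qed
qed

lemma is_cell_chord_slope_exists:
  fixes y :: "'a::euclidean_space \<Rightarrow> 'b::euclidean_space"
  assumes "finite K" "simplicial_complex K" "linear_order_on (\<Union>K) ord" "S \<in> K" "card S = m + 1"
    and "is_cell ord m l S U"
  shows "\<exists>L. chord_slope S U y L"
proof -
  note vs = simplex_list[OF assms(1-5)]
  obtain c \<pi> where c: "admissible m l c \<pi>" "U = crys_point m l (ordered_vertices ord S) c \<pi> ` {1..m+1}"
    using assms(6) by (auto simp: is_cell_def)
  then have "bij_betw \<pi> {1..m} {1..m}" by (simp add: admissible_def)
  from chord_slope_exists[OF vs(4,2,3) this, of l c y] show ?thesis using c(2) vs(1) by metis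
qed

text \<open>Cubes whose corners agree modulo 2 are equal or disjoint.\<close>

lemma same_colour_cells:
  assumes "finite K" "simplicial_complex K" "linear_order_on (\<Union>K) ord" "S \<in> K" "card S = m + 1"
    and par: "\<And>i. i \<in> {1..m} \<Longrightarrow> c i mod 2 = c' i mod 2" and pi: "\<And>i. i \<in> {1..m} \<Longrightarrow> \<pi> i = \<pi>' i"
    and k: "k \<in> {1..m+1}" "k' \<in> {1..m+1}"
    and eq: "crys_point m l (ordered_vertices ord S) c \<pi> k = crys_point m l (ordered_vertices ord S) c' \<pi>' k'"
  shows "crys_point m l (ordered_vertices ord S) c \<pi> ` {1..m+1} = crys_point m l (ordered_vertices ord S) c' \<pi>' ` {1..m+1}"
proof -
  note vs = simplex_list[OF assms(1-5)]
  have c: "c i = c' i" if i: "i \<in> {1..m}" for i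
  proof -
    \<comment> \<open>A common vertex gives \<open>c i + d = c' i + d'\<close> with both offsets in
      \<open>{0, 1}\<close>, so the corners differ by at most 1 and equal parity makes them
      equal.\<close>
    define d d' :: nat where "d = (if i \<in> \<pi> ` {k..m} then 1 else 0)" and "d' = (if i \<in> \<pi>' ` {k'..m} then 1 else 0)"
    have "crys_vertex m l c \<pi> k i = crys_vertex m l c' \<pi>' k' i"
      using iota_inv_inj[OF vs(4,2,3) eq[unfolded crys_point_def] i] .
    then have "real (c i + d) = real (c' i + d')" by (simp add: crys_vertex_def d_def d'_def split: if_splits)
    then have "c i + d = c' i + d'" by (simp only: of_nat_eq_iff)
    moreover have "d = 0 \<or> d = 1" "d' = 0 \<or> d' = 1" by (auto simp: d_def d'_def)
    ultimately show ?thesis using par[OF i] by (elim disjE) (simp_all, presburger+)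
  qed
  have "crys_point m l (ordered_vertices ord S) c \<pi> j = crys_point m l (ordered_vertices ord S) c' \<pi>' j" if "j \<in> {1..m+1}" for j
    unfolding crys_point_def
  proof (rule iota_inv_cong[OF vs(3)])
    fix i assume i: "i \<in> {1..m}"
    have "\<pi> ` {j..m} = \<pi>' ` {j..m}" using pi that by (intro image_cong) auto
    then show "crys_vertex m l c \<pi> j i = crys_vertex m l c' \<pi>' j i" using c[OF i] by (simp add: crys_vertex_def)
  qed
  then show ?thesis by (rule image_cong[OF refl])
qed

text \<open>\<open>L - A\<close> is constant on the vertices, and its level sets are convex. This
  replaces an ambient derivative, which need not lie in \<open>slopes S\<close>, by a normalised
  slope with the same action along the cell.\<close>

lemma chord_slope_hull:
  assumes L: "chord_slope S U (blinfun_apply A) L" and pq: "p \<in> convex hull U" "q \<in> convex hull U"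
  shows "L (p - q) = A (p - q)"
proof -
  obtain u where u: "u \<in> U" using pq by fastforce
  have "convex {p. (L - A) p = (L - A) u}"
    by (auto simp: convex_def blinfun.add_right blinfun.scaleR_right scaleR_add_left[symmetric])
  moreover have "U \<subseteq> {p. (L - A) p = (L - A) u}"
  proof
    fix x assume "x \<in> U"
    then have "L (x - u) = A x - A u" using L u by (simp add: chord_slope_def)
    then show "x \<in> {p. (L - A) p = (L - A) u}"
      by (simp add: blinfun.diff_left blinfun.diff_right algebra_simps)
  qed
  ultimately have "convex hull U \<subseteq> {p. (L - A) p = (L - A) u}" by (rule hull_minimal[rotated])
  then have "p \<in> {p. (L - A) p = (L - A) u}" "q \<in> {p. (L - A) p = (L - A) u}" using pq by blast+
  then have "(L - A) p = (L - A) q" by simp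
  then show ?thesis by (simp add: blinfun.diff_left blinfun.diff_right algebra_simps)
qed

text \<open>A derivative within a set is tested only on differences \<open>z - x\<close> of its
  points, so it may be changed freely in other directions.\<close>

lemma has_derivative_within_eq_on:
  fixes f :: "'a::real_normed_vector \<Rightarrow> 'b::real_normed_vector"
  assumes "(f has_derivative f') (at x within S)" "bounded_linear g'"
    and "\<And>z. z \<in> S \<Longrightarrow> f' (z - x) = g' (z - x)"
  shows "(f has_derivative g') (at x within S)"
  using assms unfolding has_derivative_within_alt by auto

section \<open>The jiggling theorem\<close>

lemma eventually_div_power2_less:
  assumes "(e::real) > 0"
  shows "eventually (\<lambda>l. Q / 2 ^ l < e) sequentially"
proof -
  have "(\<lambda>l. Q * (1 / 2) ^ l) \<longlonglongrightarrow> Q * 0" by (intro tendsto_mult tendsto_const LIMSEQ_power_zero) auto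
  then have "eventually (\<lambda>l. Q * (1 / 2) ^ l < e) sequentially" using assms order_tendstoD(2) by fastforce
  then show ?thesis by (simp add: power_divide)
qed

lemma simplex_C1_bounds:
  fixes s :: "'a::euclidean_space \<Rightarrow> 'b::euclidean_space"
  assumes "finite S" "smooth_on_set (convex hull S) s"
  shows "\<exists>D M. M \<ge> 0 \<and> (\<forall>x\<in>convex hull S. (s has_derivative blinfun_apply (D x)) (at x within convex hull S)) \<and>
    continuous_on (convex hull S) D \<and> (\<forall>x\<in>convex hull S. norm (s x) \<le> M) \<and>
    (\<forall>x\<in>convex hull S. \<forall>y\<in>convex hull S. norm (s x - s y) \<le> M * norm (x - y))"
proof -
  let ?X = "convex hull S"
  have cpt: "compact ?X" using assms by (simp add: finite_imp_compact_convex_hull)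
  obtain D :: "'a \<Rightarrow> 'a \<Rightarrow>\<^sub>L 'b" where D: "\<And>x. x \<in> ?X \<Longrightarrow> (s has_derivative D x) (at x within ?X)" "continuous_on ?X D"
    by (rule smooth_on_set_derivative[OF assms(2)]) blast
  have "continuous_on ?X s" by (rule has_derivative_continuous_on[OF D(1)])
  then have "bounded (s ` ?X)" "bounded (D ` ?X)"
    using D(2) cpt compact_continuous_image compact_imp_bounded by blast+
  then obtain M1 M2 where M: "\<And>x. x \<in> ?X \<Longrightarrow> norm (s x) \<le> M1" "\<And>x. x \<in> ?X \<Longrightarrow> norm (D x) \<le> M2"
    unfolding bounded_iff by blast
  define M where "M = max 0 (max M1 M2)"
  have "norm (s x - s y) \<le> M * norm (x - y)" if xy: "x \<in> ?X" "y \<in> ?X" for x y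
  proof (rule differentiable_bound[OF convex_convex_hull D(1)])
    fix z assume "z \<in> ?X"
    then show "onorm (blinfun_apply (D z)) \<le> M" using M(2)[of z] by (simp add: M_def norm_blinfun.rep_eq[symmetric])
  qed (use xy in auto)
  moreover have "norm (s x) \<le> M" if "x \<in> ?X" for x using M(1)[OF that] by (simp add: M_def)
  moreover have "M \<ge> 0" by (simp add: M_def)
  ultimately show ?thesis using D by blast
qed

theorem theorem6p1:
  fixes K :: "'a::euclidean_space set set" and ord :: "('a \<times> 'a) set" and m :: nat
    and R :: "'a set \<Rightarrow> ('a \<times> 'b::euclidean_space \<times> ('a \<Rightarrow>\<^sub>L 'b)) set"
    and s :: "'a \<Rightarrow> 'b" and \<epsilon> :: real
  assumes "finite K" and "simplicial_complex K"
    and "linear_order_on (\<Union>K) ord"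
    and "pure_dim K m"
    and "\<forall>S\<in>K. card S = m + 1 \<longrightarrow> open_relation S (R S) \<and> fiberwise_dense S (R S)"
    and "\<epsilon> > 0"
    and "piecewise_smooth K s"
  shows "\<exists>l s'. piecewise_linear_crys K ord l s' \<and> C1_close K ord m l s s' \<epsilon> \<and>
                piecewise_solution K ord m R l s'"
proof -
  note K = assms(1-3)
  define Top where "Top = {S \<in> K. card S = m + 1}"
  have Top: "finite Top" "\<And>S. S \<in> Top \<Longrightarrow> S \<in> K" "\<And>S. S \<in> Top \<Longrightarrow> card S = m + 1"
    using assms(1) by (auto simp: Top_def)
  have fin: "finite S" if "S \<in> Top" for S using K(2) Top(2)[OF that] by (simp add: simplicial_complex_def)
  define PC where "PC S C \<longleftrightarrow> C > 0 \<and> (\<forall>l U. is_cell ord m l S U \<longrightarrow>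
      (\<forall>u\<in>U. \<forall>w\<in>U. norm (u - w) \<le> C / 2 ^ l) \<and>
      (\<forall>(y :: 'a \<Rightarrow> 'b) L e. chord_slope S U y L \<longrightarrow>
        (\<forall>u\<in>U. \<forall>w\<in>U. norm (y u - y w) \<le> e) \<longrightarrow> norm L \<le> C * 2 ^ l * e))" for S C
  have "\<forall>S\<in>Top. \<exists>C. PC S C"
    unfolding PC_def using is_cell_bounds[OF K] Top(2,3) by blast
  then obtain CS where PC: "\<And>S. S \<in> Top \<Longrightarrow> PC S (CS S)" by metis
  have CS: "CS S > 0" if "S \<in> Top" for S using PC[OF that] by (simp add: PC_def)
  have CS': "norm (u - w) \<le> CS S / 2 ^ l" if "S \<in> Top" "is_cell ord m l S U" "u \<in> U" "w \<in> U" for S l U u w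
    using PC[OF that(1)] that(2-4) unfolding PC_def by blast
  have CS'': "norm L \<le> CS S * 2 ^ l * e" if "S \<in> Top" "is_cell ord m l S U" "chord_slope S U y L"
    "\<And>u w. u \<in> U \<Longrightarrow> w \<in> U \<Longrightarrow> norm (y u - y w) \<le> e" for S l U L e and y :: "'a \<Rightarrow> 'b"
    using PC[OF that(1)] that(2-4) unfolding PC_def by blast
  define PD where "PD S D M \<longleftrightarrow> M \<ge> 0 \<and>
      (\<forall>x\<in>convex hull S. (s has_derivative blinfun_apply (D x)) (at x within convex hull S)) \<and>
      continuous_on (convex hull S) D \<and> (\<forall>x\<in>convex hull S. norm (s x) \<le> M) \<and>
      (\<forall>x\<in>convex hull S. \<forall>y\<in>convex hull S. norm (s x - s y) \<le> M * norm (x - y))" for S D M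
  have "\<forall>S\<in>Top. \<exists>D M. PD S D M"
    unfolding PD_def using simplex_C1_bounds[OF fin] assms(7) Top(2) unfolding piecewise_smooth_def by blast
  then obtain D MS where PD: "\<And>S. S \<in> Top \<Longrightarrow> PD S (D S) (MS S)" by metis
  have MS: "MS S \<ge> 0" if "S \<in> Top" for S using PD[OF that] by (simp add: PD_def)
  have D: "(s has_derivative blinfun_apply (D S x)) (at x within convex hull S)"
    if "S \<in> Top" "x \<in> convex hull S" for S x using PD[OF that(1)] that(2) by (auto simp: PD_def)
  have MS': "norm (s x) \<le> MS S" if "S \<in> Top" "x \<in> convex hull S" for S x
    using PD[OF that(1)] that(2) by (simp add: PD_def)
  have MS'': "norm (s x - s y) \<le> MS S * norm (x - y)" if "S \<in> Top" "x \<in> convex hull S" "y \<in> convex hull S" for S x y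
    using PD[OF that(1)] that(2,3) by (simp add: PD_def)
  \<comment> \<open>Sums dominate the constants of all top simplices at once; the added 1 makes
    \<open>C\<close> positive in every case.\<close>
  define C M where "C = 1 + sum CS Top" and "M = sum MS Top"
  have CS_le: "CS S \<le> C" if "S \<in> Top" for S
    using member_le_sum[OF that, of CS] CS Top(1) by (force simp: C_def)
  have MS_le: "MS S \<le> M" if "S \<in> Top" for S
    using member_le_sum[OF that, of MS] MS Top(1) by (force simp: M_def)
  have C0: "C > 0" using sum_nonneg[of Top CS] CS by (force simp: C_def)
  have M0: "M \<ge> 0" using MS by (auto simp: M_def intro!: sum_nonneg)
  have hull: "U \<subseteq> convex hull S" "U \<noteq> {}" if "S \<in> Top" "is_cell ord m l S U" for S l U
    using is_cell_hull[OF K Top(2,3)[OF that(1)] that(2)] by auto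
  have ex: "\<exists>L. chord_slope S U y L" if "S \<in> Top" "is_cell ord m l S U" for S l U and y :: "'a \<Rightarrow> 'b"
    using is_cell_chord_slope_exists[OF K Top(2,3)[OF that(1)] that(2)] .
  have diam: "norm (u - w) \<le> C / 2 ^ l" if "S \<in> Top" "is_cell ord m l S U" "u \<in> U" "w \<in> U" for S l U u w
    by (rule order_trans[OF CS'[OF that] divide_right_mono[OF CS_le[OF that(1)]]]) simp
  have bd: "norm L \<le> C * 2 ^ l * e" if cell: "S \<in> Top" "is_cell ord m l S U" "chord_slope S U y L"
    and e: "\<And>u w. u \<in> U \<Longrightarrow> w \<in> U \<Longrightarrow> norm (y u - y w) \<le> e" for S l U L e and y :: "'a \<Rightarrow> 'b"
  proof -
    obtain u where "u \<in> U" using hull(2)[OF cell(1,2)] by blast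
    from e[OF this this] have "e \<ge> 0" by simp
    then have "CS S * 2 ^ l * e \<le> C * 2 ^ l * e" using CS_le[OF cell(1)] by (intro mult_right_mono) auto
    then show ?thesis using CS''[OF cell e] by linarith
  qed
  have Lip: "norm (s u - s w) \<le> M * (C / 2 ^ l)" if "S \<in> Top" "u \<in> convex hull S" "w \<in> convex hull S"
    "norm (u - w) \<le> C / 2 ^ l" for S u w l
    by (rule order_trans[OF MS''[OF that(1-3)] mult_mono[OF MS_le[OF that(1)] that(4) M0]]) simp
  \<comment> \<open>\<open>M\<close> bounds the values of \<open>s\<close>. Its chord slopes are
    bounded by \<open>C * 2 ^ l\<close> times the variation \<open>M * (C / 2 ^ l)\<close> over a
    cell, that is by \<open>C\<^sup>2 * M\<close>, independently of \<open>l\<close>.\<close>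
  define B where "B = max M (C\<^sup>2 * M)"
  have LB: "norm L \<le> B" if "S \<in> Top" "is_cell ord m l S U" "chord_slope S U s L" for S l U L
  proof -
    have "norm L \<le> C * 2 ^ l * (M * (C / 2 ^ l))"
      by (rule bd[OF that], rule Lip[OF that(1)]) (use hull[OF that(1,2)] diam[OF that(1,2)] in auto)
    also have "\<dots> = C\<^sup>2 * M" by (simp add: power2_eq_square)
    finally show ?thesis by (simp add: B_def)
  qed
  have sB: "norm (s u) \<le> B" if "S \<in> Top" "u \<in> convex hull S" for S u
    using MS'[OF that] MS_le[OF that(1)] by (simp add: B_def)
  \<comment> \<open>The colours. Corner parities and permutations enter only through their values on
    \<open>{1..m}\<close>, and restricting them there makes the set finite.\<close>
  define F where "F = Top \<times> ({1..m} \<rightarrow>\<^sub>E {0..1::nat}) \<times> ({1..m} \<rightarrow>\<^sub>E {1..m::nat})"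
  define col where "col S c \<pi> = (S, restrict (\<lambda>i. c i mod 2 :: nat) {1..m}, restrict \<pi> {1..m})"
    for S :: "'a set" and c :: "nat \<Rightarrow> nat" and \<pi> :: "nat \<Rightarrow> nat"
  define cells where "cells l = {(col S c \<pi>, crys_point m l (ordered_vertices ord S) c \<pi> ` {1..m+1}) | S c \<pi>.
      S \<in> Top \<and> admissible m l c \<pi>}" for l
  define b :: "'a set \<Rightarrow> 'a" where "b U = (SOME u. u \<in> U)" for U
  have "finite F" unfolding F_def by (intro finite_cartesian_product finite_PiE Top) auto
  have cells: "fst k \<in> Top \<and> is_cell ord m l (fst k) U" if kU: "(k, U) \<in> cells l" for k U l
  proof -
    obtain S c \<pi> where "k = col S c \<pi>" "S \<in> Top" "admissible m l c \<pi>"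
      "U = crys_point m l (ordered_vertices ord S) c \<pi> ` {1..m+1}"
      using kU unfolding cells_def by blast
    then show ?thesis unfolding col_def is_cell_def fst_conv by auto
  qed
  have cells_ex: "\<exists>k. (k, U) \<in> cells l \<and> k \<in> F \<and> fst k = S" if S: "S \<in> Top" and U: "is_cell ord m l S U" for S U l
  proof -
    obtain c \<pi> where c: "admissible m l c \<pi>" "U = crys_point m l (ordered_vertices ord S) c \<pi> ` {1..m+1}"
      using U by (auto simp: is_cell_def)
    have "\<pi> i \<in> {1..m}" if "i \<in> {1..m}" for i
      using c(1) that unfolding admissible_def by (blast dest: bij_betwE)
    then have "col S c \<pi> \<in> F" using S by (auto simp: F_def col_def)
    moreover have "(col S c \<pi>, U) \<in> cells l" unfolding cells_def using c S by blast
    ultimately show ?thesis by (intro exI[of _ "col S c \<pi>"]) (simp add: col_def)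
  qed
  have disj: "U = U'" if "(k, U) \<in> cells l" "(k, U') \<in> cells l" "U \<inter> U' \<noteq> {}" for l k U U'
  proof -
    obtain S c \<pi> where 1: "k = col S c \<pi>" "S \<in> Top" "U = crys_point m l (ordered_vertices ord S) c \<pi> ` {1..m+1}"
      using \<open>(k, U) \<in> cells l\<close> unfolding cells_def by blast
    obtain S' c' \<pi>' where 2: "k = col S' c' \<pi>'" "U' = crys_point m l (ordered_vertices ord S') c' \<pi>' ` {1..m+1}"
      using \<open>(k, U') \<in> cells l\<close> unfolding cells_def by blast
    have eq: "S' = S" "restrict (\<lambda>i. c i mod 2) {1..m} = restrict (\<lambda>i. c' i mod 2) {1..m}"
      "restrict \<pi> {1..m} = restrict \<pi>' {1..m}" using 1(1) 2(1) by (auto simp: col_def)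
    obtain j j' where j: "j \<in> {1..m+1}" "j' \<in> {1..m+1}"
      "crys_point m l (ordered_vertices ord S) c \<pi> j = crys_point m l (ordered_vertices ord S) c' \<pi>' j'"
      using \<open>U \<inter> U' \<noteq> {}\<close> unfolding 1(3) 2(2) eq(1) by blast
    have "crys_point m l (ordered_vertices ord S) c \<pi> ` {1..m+1} = crys_point m l (ordered_vertices ord S) c' \<pi>' ` {1..m+1}"
    proof (rule same_colour_cells[OF K Top(2,3)[OF 1(2)] _ _ j])
      fix i assume "i \<in> {1..m}"
      then show "c i mod 2 = c' i mod 2" "\<pi> i = \<pi>' i"
        using fun_cong[OF eq(2), of i] fun_cong[OF eq(3), of i] by auto
    qed
    then show ?thesis using 1(3) 2(2) eq(1) by simp
  qed
  have base: "b U \<in> U" if "S \<in> Top" "is_cell ord m l S U" for S l U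
    unfolding b_def using hull(2)[OF that] by (simp add: some_in_eq)
  \<comment> \<open>Values moved by \<open>\<delta> / 2 ^ l\<close> change chord slopes by at most
    \<open>2 * C * \<delta>\<close>, which is half of \<open>\<epsilon>\<close>.\<close>
  define \<delta> where "\<delta> = \<epsilon> / (4 * C)"
  have \<delta>: "\<delta> > 0" "2 * C * \<delta> = \<epsilon> / 2" using assms(6) C0 by (auto simp: \<delta>_def)
  have dens: "\<exists>r>0. \<forall>x\<in>convex hull (fst k). \<forall>y. \<forall>L\<in>slopes (fst k). norm y \<le> B' \<and> norm L \<le> B' \<longrightarrow>
           (\<exists>L'\<in>slopes (fst k). dist L' L < \<delta>' \<and> deep (R (fst k)) (fst k) r x y L')"
    if "k \<in> F" "\<delta>' > 0" for k \<delta>' B'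
  proof -
    have S: "fst k \<in> Top" using that(1) by (auto simp: F_def)
    then show ?thesis
      using uniform_density[OF fin[OF S] _ _ that(2)] assms(5) Top(2,3)[OF S] by blast
  qed
  define PY where "PY r l y \<longleftrightarrow> (\<forall>p. norm (y p - s p) \<le> \<delta> / 2 ^ l) \<and>
     (\<forall>k\<in>F. \<forall>U L. (k, U) \<in> cells l \<longrightarrow> chord_slope (fst k) U y L \<longrightarrow>
        deep (R (fst k)) (fst k) r (b U) (s (b U)) L)" for r l y
  have "\<exists>r>0. \<forall>l. \<exists>y. PY r l y" unfolding PY_def
  proof (rule jiggle_colours[where C = C and B = B])
    show "U \<subseteq> convex hull fst k" "b U \<in> U" if "(k, U) \<in> cells l" for l k U
      using cells[OF that] hull(1) base by auto
    show "norm (u - w) \<le> C / 2 ^ l" if "(k, U) \<in> cells l" "u \<in> U" "w \<in> U" for l k U u w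
      using diam cells[OF that(1)] that(2,3) by blast
    show "\<exists>L. chord_slope (fst k) U y L" if "(k, U) \<in> cells l" for l k U and y :: "'a \<Rightarrow> 'b"
      using ex cells[OF that] by blast
    show "norm L \<le> C * 2 ^ l * e" if "(k, U) \<in> cells l" "chord_slope (fst k) U y L"
      "\<And>u w. u \<in> U \<Longrightarrow> w \<in> U \<Longrightarrow> norm (y u - y w) \<le> e" for l k U L e and y :: "'a \<Rightarrow> 'b"
      by (rule bd[of "fst k" l U y L e]) (use cells[OF that(1)] that(2,3) in auto)
    show "norm (s u) \<le> B" if "(k, U) \<in> cells l" "u \<in> U" for l k U u
      using sB[of "fst k" u] cells[OF that(1)] hull(1)[of "fst k" l U] that(2) by blast
    show "norm L \<le> B" if "(k, U) \<in> cells l" "chord_slope (fst k) U s L" for l k U L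
      using LB cells[OF that(1)] that(2) by blast
  qed (fact \<open>finite F\<close> C0 \<delta>(1) dens disj)+
  then obtain r Y where r: "r > 0" and PY: "\<And>l. PY r l (Y l)" by metis
  have Y: "norm (Y l p - s p) \<le> \<delta> / 2 ^ l" for l p using PY[of l] by (simp add: PY_def)
  have deepY: "deep (R (fst k)) (fst k) r (b U) (s (b U)) L"
    if "k \<in> F" "(k, U) \<in> cells l" "chord_slope (fst k) U (Y l) L" for l k U L
    using PY[of l] that unfolding PY_def by blast
  \<comment> \<open>The chord slope of \<open>s\<close> then deviates from its derivative by at most
    \<open>C\<^sup>2 * \<eta> = \<epsilon> / 4\<close>, so the total \<open>C^1\<close> error of the
    slopes stays at \<open>3 * \<epsilon> / 4\<close>.\<close>
  define \<eta> where "\<eta> = \<epsilon> / (4 * C\<^sup>2)"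
  have \<eta>: "\<eta> > 0" "C\<^sup>2 * \<eta> = \<epsilon> / 4" using assms(6) C0 by (auto simp: \<eta>_def)
  \<comment> \<open>Up to the factor \<open>1 / 2 ^ l\<close>, the summands are the diameter of a
    cell, the variation of \<open>s\<close> on it, the displacement at the base vertex, and the
    variation of \<open>s'\<close>, whose slopes are bounded by
    \<open>B + 2 * C * \<delta>\<close>.\<close>
  define Q where "Q = C + M * C + \<delta> + (B + 2 * C * \<delta>) * C"
  have "B \<ge> 0" using M0 by (auto simp: B_def)
  define PR where "PR S \<rho> \<longleftrightarrow> \<rho> > 0 \<and> (\<forall>x\<in>convex hull S. \<forall>u\<in>convex hull S. \<forall>w\<in>convex hull S.
      dist x u < \<rho> \<and> dist x w < \<rho> \<longrightarrow> norm (s u - s w - D S x (u - w)) \<le> \<eta> * norm (u - w))" for S \<rho>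
  have "\<exists>\<rho>. PR S \<rho>" if S: "S \<in> Top" for S unfolding PR_def
  proof (rule uniform_linearization[OF finite_imp_compact_convex_hull[OF fin[OF S]] convex_convex_hull D[OF S] _ \<eta>(1)])
    show "continuous_on (convex hull S) (D S)" using PD[OF S] by (simp add: PD_def)
  qed
  then obtain \<rho> where PR: "\<And>S. S \<in> Top \<Longrightarrow> PR S (\<rho> S)" by metis
  have \<rho>: "\<rho> S > 0" if "S \<in> Top" for S using PR[OF that] by (simp add: PR_def)
  have lin: "norm (s u - s w - D S x (u - w)) \<le> \<eta> * norm (u - w)"
    if "S \<in> Top" "x \<in> convex hull S" "u \<in> convex hull S" "w \<in> convex hull S" "dist x u < \<rho> S" "dist x w < \<rho> S"
    for S x u w
    using PR[OF that(1)] that(2-) by (simp add: PR_def)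
  \<comment> \<open>The radii \<open>\<rho> S\<close> and \<open>r\<close> are already fixed and the
    jiggled values \<open>Y l\<close> exist for every \<open>l\<close>, so the level can now be
    taken as large as needed.\<close>
  have "eventually (\<lambda>l. \<forall>S\<in>Top. Q / 2 ^ l < \<rho> S) sequentially"
    by (intro eventually_ball_finite Top(1) ballI eventually_div_power2_less \<rho>)
  then have "eventually (\<lambda>l. (\<forall>S\<in>Top. Q / 2 ^ l < \<rho> S) \<and> Q / 2 ^ l < r \<and> Q / 2 ^ l < \<epsilon>) sequentially"
    by (intro eventually_conj eventually_div_power2_less r assms(6))
  then obtain l where l: "\<And>S. S \<in> Top \<Longrightarrow> Q / 2 ^ l < \<rho> S" "Q / 2 ^ l < r" "Q / 2 ^ l < \<epsilon>"
    using eventually_happens'[OF sequentially_bot] by blast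
  define s' where "s' = crys_interp K ord l (Y l)"
  \<comment> \<open>Stated for every dimension \<open>n\<close>, because piecewise linearity is
    required on all simplices of \<open>K\<close>.\<close>
  have aff: "s' x = Y l u + L (x - u)" if assm: "S \<in> K" "card S = n + 1" "is_cell ord n l S U" "chord_slope S U (Y l) L"
    "x \<in> convex hull U" "u \<in> U" for S n U L x u
  proof -
    obtain c \<pi> where "admissible n l c \<pi>" "U = crys_point n l (ordered_vertices ord S) c \<pi> ` {1..n+1}"
      using assm(3) by (auto simp: is_cell_def)
    from crys_interp_affine[OF K assm(1,2) this assm(4-6)] show ?thesis by (simp add: s'_def)
  qed
  have crys: "\<exists>U. \<sigma> = convex hull U \<and> is_cell ord n l S U" if "S \<in> K" "card S = n + 1" "\<sigma> \<in> crys_simplices ord l S" for S n \<sigma>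
    using that(3) simplex_list(3)[OF K that(1,2)] by (auto simp: crys_simplices_eq is_cell_def)
  have "piecewise_linear_crys K ord l s'" unfolding piecewise_linear_crys_def
  proof (intro conjI ballI)
    show "continuous_on (polyhedron K) s'" unfolding s'_def by (rule continuous_on_crys_interp[OF K(1,2)])
    fix S \<sigma> assume S: "S \<in> K" and \<sigma>: "\<sigma> \<in> crys_simplices ord l S"
    have "finite S" "S \<noteq> {}" using K(2) S by (auto simp: simplicial_complex_def)
    then have "card S > 0" by (simp add: card_gt_0_iff)
    then obtain n where n: "card S = n + 1" by (cases "card S") auto
    obtain U where U: "\<sigma> = convex hull U" "is_cell ord n l S U" using crys[OF S n \<sigma>] by blast
    obtain L where L: "chord_slope S U (Y l) L" using is_cell_chord_slope_exists[OF K S n U(2)] by blast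
    obtain u where u: "u \<in> U" using is_cell_hull(2)[OF K S n U(2)] by blast
    have "s' x = L x + (Y l u - L u)" if "x \<in> \<sigma>" for x
      using aff[OF S n U(2) L _ u] that U(1) by (simp add: blinfun.diff_right)
    then show "\<exists>A b. linear A \<and> (\<forall>x\<in>\<sigma>. s' x = A x + b)"
      using bounded_linear.linear[OF blinfun.bounded_linear_right[of L]] by blast
  qed
  moreover
  have top_cell: "\<exists>L0 L. L0 \<in> slopes S \<and> L \<in> slopes S \<and> (s has_derivative blinfun_apply L0) (at x within \<sigma>) \<and>
      (s' has_derivative blinfun_apply L) (at x within \<sigma>) \<and> norm (L0 - L) < \<epsilon> \<and> norm (s x - s' x) < \<epsilon> \<and>
      (x, s' x, L) \<in> R S" if S: "S \<in> K" "card S = m + 1" and \<sigma>: "\<sigma> \<in> crys_simplices ord l S" and x: "x \<in> \<sigma>" for S \<sigma> x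
  proof -
    have ST: "S \<in> Top" using S by (simp add: Top_def)
    obtain U where U: "\<sigma> = convex hull U" "is_cell ord m l S U" using crys[OF S \<sigma>] by blast
    note cell = ST U(2)
    have \<sigma>S: "\<sigma> \<subseteq> convex hull S" using hull_mono[OF hull(1)[OF cell], of convex] U(1) by (simp add: hull_hull)
    have xS: "x \<in> convex hull S" using x \<sigma>S by blast
    have near: "norm (x - u) \<le> C / 2 ^ l" if "u \<in> U" for u
    proof -
      have "U \<subseteq> cball u (C / 2 ^ l)" using diam[OF cell that] by (auto simp: dist_norm)
      then have "convex hull U \<subseteq> cball u (C / 2 ^ l)" by (rule hull_minimal) auto
      then show ?thesis using x U(1) by (auto simp: dist_norm norm_minus_commute)
    qed
    obtain L where L: "chord_slope S U (Y l) L" using ex[OF cell] by blast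
    obtain Ls where Ls: "chord_slope S U s Ls" using ex[OF cell] by blast
    \<comment> \<open>The representative in \<open>slopes S\<close> of the derivative of
      \<open>s\<close> at \<open>x\<close>, obtained by interpolating the linear map
      \<open>D S x\<close> on the vertices.\<close>
    obtain L0 where L0: "chord_slope S U (blinfun_apply (D S x)) L0" using ex[OF cell] by blast
    have nL: "norm (L - Ls) \<le> 2 * C * \<delta>"
    proof -
      have "norm (L - Ls) \<le> C * 2 ^ l * (2 * \<delta> / 2 ^ l)"
      proof (rule bd[OF cell chord_slope_diff[OF L Ls]])
        fix u w
        have "norm (Y l u - s u - (Y l w - s w)) \<le> \<delta> / 2 ^ l + \<delta> / 2 ^ l"
          by (rule norm_triangle_le_diff[OF add_mono[OF Y Y]])
        then show "norm (Y l u - s u - (Y l w - s w)) \<le> 2 * \<delta> / 2 ^ l" by simp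
      qed
      then show ?thesis by simp
    qed
    have Cl: "C / 2 ^ l \<le> Q / 2 ^ l" "M * (C / 2 ^ l) + (\<delta> / 2 ^ l + (B + 2 * C * \<delta>) * (C / 2 ^ l)) \<le> Q / 2 ^ l"
      using C0 M0 \<delta>(1) \<open>B \<ge> 0\<close> by (auto simp: Q_def add_divide_distrib intro!: divide_nonneg_nonneg)
    have nL0: "norm (L0 - Ls) \<le> \<epsilon> / 4"
    proof -
      have "norm (L0 - Ls) \<le> C * 2 ^ l * (\<eta> * (C / 2 ^ l))"
      proof (rule bd[OF cell chord_slope_diff[OF L0 Ls]])
        fix u w assume uw: "u \<in> U" "w \<in> U"
        have "norm (s u - s w - D S x (u - w)) \<le> \<eta> * norm (u - w)"
        proof (rule lin[OF ST xS])
          show "dist x u < \<rho> S" "dist x w < \<rho> S"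
            using near[OF uw(1)] near[OF uw(2)] Cl(1) l(1)[OF ST] by (auto simp: dist_norm)
        qed (use uw hull(1)[OF cell] in auto)
        also have "\<dots> \<le> \<eta> * (C / 2 ^ l)" using diam[OF cell uw] \<eta>(1) by (intro mult_left_mono) auto
        finally show "norm (D S x u - s u - (D S x w - s w)) \<le> \<eta> * (C / 2 ^ l)"
          by (simp add: blinfun.diff_right norm_minus_commute algebra_simps)
      qed
      also have "\<dots> = C\<^sup>2 * \<eta>" by (simp add: power2_eq_square)
      finally show ?thesis using \<eta>(2) by simp
    qed
    have "norm (L0 - L) < \<epsilon>"
      using norm_triangle_ineq4[of "L0 - Ls" "L - Ls"] nL nL0 \<delta>(2) assms(6) by simp
    moreover have "norm L \<le> B + 2 * C * \<delta>"
      using norm_triangle_sub[of L Ls] nL LB[OF cell Ls] by simp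
    moreover define u where "u = b U"
    then have u: "u \<in> U" using base[OF cell] by simp
    have s'x: "s' x = Y l u + L (x - u)" using aff[OF S U(2) L _ u] x U(1) by simp
    have Lx: "norm (L (x - u)) \<le> (B + 2 * C * \<delta>) * (C / 2 ^ l)"
      by (rule order_trans[OF norm_blinfun mult_mono[OF calculation(2) near[OF u]]])
        (use C0 \<open>B \<ge> 0\<close> \<delta>(1) in auto)
    have "s' x - s u = (Y l u - s u) + L (x - u)" by (simp add: s'x)
    then have s'u: "norm (s' x - s u) \<le> \<delta> / 2 ^ l + (B + 2 * C * \<delta>) * (C / 2 ^ l)"
      by (simp only: norm_triangle_mono[OF Y Lx])
    have "norm (s x - s u) \<le> M * (C / 2 ^ l)" by (rule Lip[OF ST xS _ near[OF u]]) (use u hull(1)[OF cell] in auto)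
    then have "norm (s x - s' x) < \<epsilon>"
      using s'u norm_triangle_ineq4[of "s x - s u" "s' x - s u"] Cl(2) l(3) by simp
    moreover have "(x, s' x, L) \<in> R S"
    proof -
      obtain k where k: "(k, U) \<in> cells l" "k \<in> F" "fst k = S" using cells_ex[OF cell] by blast
      \<comment> \<open>The radius \<open>r\<close> absorbs the passage from \<open>u\<close> to
        \<open>x\<close> and from \<open>s u\<close> to \<open>s' x\<close>; the slope
        \<open>L\<close> is the same on the whole cell.\<close>
      have "deep (R S) S r u (s u) L" using deepY[OF k(2,1)] k(3) L u_def by simp
      moreover have "dist x u < r" using near[OF u] Cl(1) l(2) by (simp add: dist_norm)
      moreover have "dist (s' x) (s u) < r"
      proof -
        have "0 \<le> M * (C / 2 ^ l)" using M0 C0 by simp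
        then show ?thesis using s'u Cl(2) l(2) by (simp add: dist_norm)
      qed
      moreover have "L \<in> slopes S" using L by (simp add: chord_slope_def)
      ultimately show ?thesis using xS r by (simp add: deep_def)
    qed
    moreover have "(s has_derivative blinfun_apply L0) (at x within \<sigma>)"
    proof (rule has_derivative_within_eq_on[OF has_derivative_subset[OF D[OF ST xS] \<sigma>S] blinfun.bounded_linear_right])
      fix z assume "z \<in> \<sigma>"
      then show "D S x (z - x) = L0 (z - x)" using chord_slope_hull[OF L0] x U(1) by simp
    qed
    moreover have "(s' has_derivative blinfun_apply L) (at x within \<sigma>)"
    proof (rule has_derivative_transform[OF x])
      show "s' z = Y l u + L (z - u)" if "z \<in> \<sigma>" for z using aff[OF S U(2) L _ u] that U(1) by simp
      show "((\<lambda>z. Y l u + L (z - u)) has_derivative blinfun_apply L) (at x within \<sigma>)"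
        by (auto intro!: derivative_eq_intros bounded_linear_imp_has_derivative simp: blinfun.diff_right blinfun.bounded_linear_right)
    qed
    moreover have "L \<in> slopes S" "L0 \<in> slopes S" using L L0 by (auto simp: chord_slope_def)
    ultimately show ?thesis by blast
  qed
  have "C1_close K ord m l s s' \<epsilon>" unfolding C1_close_def using top_cell by blast
  moreover have "piecewise_solution K ord m R l s'" unfolding piecewise_solution_def using top_cell by blast
  ultimately show ?thesis by blast
qed

end
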